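(* Let $a<b$ be real numbers and let $n,r,m$ be integers with $n\geq r\geq 1$ and $m\geq 1$. Let $A_{r-l}\in (C^{(n-r)})^{m\times m}$ for $1\leq l\leq r$, and let $B:(C^{(n)})^{m}\to\mathbb{C}^{rm}$ be a continuous linear operator. Assume that the boundary-value problem $$y^{(r)}(t)+\sum_{l=1}^{r}A_{r-l}(t)y^{(r-l)}(t)=f(t)\ \ (a\leq t\leq b),\qquad By=q,$$ has a unique solution $y\in(C^{(n)})^{m}$ for every $f\in(C^{(n-r)})^{m}$ and every $q\in\mathbb{C}^{rm}$. Let $\mathcal{X}$ be a dense subset of $(C^{(n-r)})^{m\times m}$. Then there exist, for each integer $k\geq 1$, matrix-valued functions $A_{r-l,k}\in\mathcal{X}$ ($1\leq l\leq r$), a number $p_k\in\mathbb{N}$, points $t_{k,j}\in[a,b]$ ($1\leq j\leq p_k$), and matrices $\beta_k^{j,l}\in\mathbb{C}^{rm\times m}$ ($1\leq j\leq p_k$, $0\leq l\leq n$), all chosen independently of $f$ and $q$, such that the following holds. Consider the multipoint boundary-value problems $$y_k^{(r)}(t)+\sum_{l=1}^{r}A_{r-l,k}(t)y_k^{(r-l)}(t)=f(t)\ \ (a\leq t\leq b),\qquad \sum_{j=1}^{p_k}\sum_{l=0}^{n}\beta_k^{j,l}\,y_k^{(l)}(t_{k,j})=q,$$ with unknown $y_k\in(C^{(n)})^{m}$. Then there is $k_0$ such that for every $k\geq k_0$ these problems have a unique solution $y_k\in(C^{(n)})^m$ for every $f\in(C^{(n-r)})^{m}$ and $q\in\mathbb{C}^{rm}$,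 and for all $f\in(C^{(n-r)})^{m}$, $q\in\mathbb{C}^{rm}$ one has $y_k\to y$ in $(C^{(n)})^{m}$ as $k\to\infty$, where $y$ is the solution of the original problem with the same $f$ and $q$.
   Context: For an integer $l\geq 0$, $C^{(l)}=C^{(l)}([a,b],\mathbb{C})$ is the Banach space of $l$ times continuously differentiable complex-valued functions on $[a,b]$ with norm $\|x\|_{(l)}=\sum_{j=0}^{l}\max_{a\leq t\leq b}|x^{(j)}(t)|$. $(C^{(l)})^{m}$ and $(C^{(l)})^{m\times m}$ denote the Banach spaces of $\mathbb{C}^m$-valued, respectively $\mathbb{C}^{m\times m}$-valued, functions on $[a,b]$ whose components all lie in $C^{(l)}$, normed by the sum of the $\|\cdot\|_{(l)}$-norms of the components. *)

theory Defs
  imports "HOL-Analysis.Analysis"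
begin

fun hderiv :: "real \<Rightarrow> real \<Rightarrow> nat \<Rightarrow> (real \<Rightarrow> complex) \<Rightarrow> real \<Rightarrow> complex" where
  "hderiv a b 0 x = x"
| "hderiv a b (Suc j) x = (\<lambda>t. vector_derivative (hderiv a b j x) (at t within {a..b}))"

definition Cl :: "real \<Rightarrow> real \<Rightarrow> nat \<Rightarrow> (real \<Rightarrow> complex) \<Rightarrow> bool" where
  "Cl a b l x \<longleftrightarrow>
     (\<forall>j<l. \<forall>t\<in>{a..b}. (hderiv a b j x has_vector_derivative hderiv a b (Suc j) x t) (at t within {a..b}))
   \<and> (\<forall>j\<le>l. continuous_on {a..b} (hderiv a b j x))"

definition cnorm :: "real \<Rightarrow> real \<Rightarrow> nat \<Rightarrow> (real \<Rightarrow> complex) \<Rightarrow> real" where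
  "cnorm a b l x = (\<Sum>j\<le>l. Sup ((\<lambda>t. norm (hderiv a b j x t)) ` {a..b}))"

text \<open>(C^(l))^m: vector functions y :: nat \<Rightarrow> real \<Rightarrow> complex with components y i, i<m,
  normalised to be 0 outside the index range and outside [a,b] (so that elements
  are determined by their values on the relevant domain).\<close>
definition Cvec :: "real \<Rightarrow> real \<Rightarrow> nat \<Rightarrow> nat \<Rightarrow> (nat \<Rightarrow> real \<Rightarrow> complex) set" where
  "Cvec a b l m = {y. (\<forall>i<m. Cl a b l (y i)) \<and> (\<forall>i t. (m \<le> i \<or> t \<notin> {a..b}) \<longrightarrow> y i t = 0)}"

definition cvnorm :: "real \<Rightarrow> real \<Rightarrow> nat \<Rightarrow> nat \<Rightarrow> (nat \<Rightarrow> real \<Rightarrow> complex) \<Rightarrow> real" where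
  "cvnorm a b l m y = (\<Sum>i<m. cnorm a b l (y i))"

definition Cmat :: "real \<Rightarrow> real \<Rightarrow> nat \<Rightarrow> nat \<Rightarrow> (nat \<Rightarrow> nat \<Rightarrow> real \<Rightarrow> complex) set" where
  "Cmat a b l m = {A. (\<forall>i<m. \<forall>j<m. Cl a b l (A i j)) \<and>
      (\<forall>i j t. (m \<le> i \<or> m \<le> j \<or> t \<notin> {a..b}) \<longrightarrow> A i j t = 0)}"

definition cmnorm :: "real \<Rightarrow> real \<Rightarrow> nat \<Rightarrow> nat \<Rightarrow> (nat \<Rightarrow> nat \<Rightarrow> real \<Rightarrow> complex) \<Rightarrow> real" where
  "cmnorm a b l m A = (\<Sum>i<m. \<Sum>j<m. cnorm a b l (A i j))"

text \<open>Vectors in \<complex>^(rm) are functions nat \<Rightarrow> complex, only indices < r*m matter.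
  B is a continuous linear operator (C^(n))^m \<rightarrow> \<complex>^(rm).\<close>
definition cont_linear_bop :: "real \<Rightarrow> real \<Rightarrow> nat \<Rightarrow> nat \<Rightarrow> nat \<Rightarrow>
    ((nat \<Rightarrow> real \<Rightarrow> complex) \<Rightarrow> nat \<Rightarrow> complex) \<Rightarrow> bool" where
  "cont_linear_bop a b n m N B \<longleftrightarrow>
     (\<forall>y\<in>Cvec a b n m. \<forall>z\<in>Cvec a b n m. \<forall>i<N. B (\<lambda>i t. y i t + z i t) i = B y i + B z i)
   \<and> (\<forall>y\<in>Cvec a b n m. \<forall>c::complex. \<forall>i<N. B (\<lambda>i t. c * y i t) i = c * B y i)
   \<and> (\<forall>y0\<in>Cvec a b n m. \<forall>e>0. \<exists>d>0. \<forall>y\<in>Cvec a b n m.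
        cvnorm a b n m (\<lambda>i t. y i t - y0 i t) < d \<longrightarrow> (\<Sum>i<N. norm (B y i - B y0 i)) < e)"

text \<open>The differential equation y^(r) + sum_{l=1}^r A_{r-l} y^(r-l) = f on [a,b];
  A s is the coefficient A_s, s = r - l ranging over {0..<r}.\<close>
definition solves_ode :: "real \<Rightarrow> real \<Rightarrow> nat \<Rightarrow> nat \<Rightarrow> (nat \<Rightarrow> nat \<Rightarrow> nat \<Rightarrow> real \<Rightarrow> complex)
    \<Rightarrow> (nat \<Rightarrow> real \<Rightarrow> complex) \<Rightarrow> (nat \<Rightarrow> real \<Rightarrow> complex) \<Rightarrow> bool" where
  "solves_ode a b r m A f y \<longleftrightarrow>
     (\<forall>t\<in>{a..b}. \<forall>i<m.
        hderiv a b r (y i) t + (\<Sum>s<r. \<Sum>j<m. A s i j t * hderiv a b s (y j) t) = f i t)"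

definition multipoint_bc :: "real \<Rightarrow> real \<Rightarrow> nat \<Rightarrow> nat \<Rightarrow> nat \<Rightarrow> nat \<Rightarrow> (nat \<Rightarrow> real)
    \<Rightarrow> (nat \<Rightarrow> nat \<Rightarrow> nat \<Rightarrow> nat \<Rightarrow> complex) \<Rightarrow> (nat \<Rightarrow> complex) \<Rightarrow> (nat \<Rightarrow> real \<Rightarrow> complex) \<Rightarrow> bool" where
  "multipoint_bc a b n r m p tp \<beta> q y \<longleftrightarrow>
     (\<forall>i<r*m. (\<Sum>j=1..p. \<Sum>l\<le>n. \<Sum>c<m. \<beta> j l i c * hderiv a b l (y c) (tp j)) = q i)"

end

theory Submission
  imports Defs "HOL-Probability.Discrete_Topology"
begin

text \<open>
  Let \<open>P\<close> and \<open>P\<^sub>k\<close> be the differential operators with coefficients \<open>A\<close> and \<open>A\<^sub>k\<close>, where the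
  \<open>A\<^sub>k \<in> X\<close> converge to \<open>A\<close>.  Rewriting initial value problems as Volterra equations for the highest
  derivative and contracting in an exponentially weighted norm gives solvability with a bound that is
  uniform in \<open>k\<close>.  Hence every \<open>z\<close> has a companion \<open>V\<^sub>k z\<close> with the same initial data at \<open>a\<close> and
  \<open>P\<^sub>k (V\<^sub>k z) = P z\<close>, and \<open>V\<^sub>k z\<close> converges to \<open>z\<close> in \<open>C\<^sup>n\<close>.

  The operators \<open>B\<^sub>k\<close> are \<open>B \<circ> T\<^sub>k\<close>, where \<open>T\<^sub>k y\<close> adds to the Taylor polynomial of \<open>y\<close> at \<open>a\<close> the
  \<open>n\<close>-fold primitive of the \<open>k\<close>-th Bernstein polynomial of the \<open>n\<close>-th derivative of \<open>y\<close>.  This uses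
  only point values of derivatives, the \<open>T\<^sub>k\<close> are uniformly bounded, and they converge strongly to
  the identity.  So no representation theorem for \<open>B\<close> is needed.

  If \<open>P Y\<^sub>i = 0\<close> and \<open>B Y\<^sub>i\<close> is the \<open>i\<close>-th unit vector, then the solutions of \<open>P\<^sub>k x = f\<close> are
  \<open>V\<^sub>k y + (\<Sum>i. c\<^sub>i V\<^sub>k Y\<^sub>i)\<close> with \<open>P y = f\<close>, and the boundary condition becomes a linear system for
  \<open>c\<close> whose matrix \<open>B\<^sub>k (V\<^sub>k Y\<^sub>i)\<close> tends to the identity.  If moreover \<open>B y = q\<close>, then the right-hand
  side \<open>q - B\<^sub>k (V\<^sub>k y)\<close> tends to 0, so \<open>c\<close> tends to 0 and \<open>x\<close> to \<open>y\<close>.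
\<close>

subsection \<open>Perturbations of the identity\<close>

text \<open>The Banach fixed point theorem for \<open>x \<mapsto> g - T x\<close>. It is used twice:
  for the linear system that determines the coefficients \<open>c\<close>, and for Volterra
  equations in a weighted norm.\<close>

lemma id_plus_contraction_surj:
  fixes T :: "'a::{real_normed_vector, complete_space} \<Rightarrow> 'a"
  assumes diff: "\<And>x y. T (x - y) = T x - T y"
    and bound: "\<And>x. norm (T x) \<le> c * norm x" and c: "0 \<le> c" "c < 1"
  shows "\<exists>u. u + T u = g"
proof -
  have "dist (g - T x) (g - T y) \<le> c * dist x y" for x y
    using bound[of "y - x"] by (simp add: dist_norm diff norm_minus_commute)
  then obtain u where "g - T u = u"
    using banach_fix_type[of c "\<lambda>x. g - T x"] c by blast
  then show ?thesis by (metis diff_add_cancel)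
qed

text \<open>Bounded continuous functions form a complete space only over a metric domain, and \<open>nat\<close> is not
  an instance of \<open>metric_space\<close>; component indices are therefore taken from its discrete copy.\<close>

lemma bcontfun_discrete_prodI:
  fixes f :: "'i discrete \<times> 'b::topological_space \<Rightarrow> 'c::real_normed_vector"
  assumes "\<And>i. continuous_on UNIV (\<lambda>t. f (i, t))" and "\<And>p. norm (f p) \<le> K"
  shows "f \<in> bcontfun"
proof (rule bcontfun_normI[OF _ assms(2)])
  \<comment> \<open>The index space is discrete, so the slices are open and continuity on each slice
    glues to continuity on their union.\<close>
  have "continuous_on ({i} \<times> UNIV) f" for i
  proof -
    have "continuous_on ({i} \<times> UNIV) (\<lambda>p. f (i, snd p))"
      by (rule continuous_on_compose2[OF assms(1)]) (auto intro: continuous_on_snd continuous_on_id)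
    then show ?thesis by (rule continuous_on_eq) auto
  qed
  then have "continuous_on (\<Union>i\<in>UNIV. {i} \<times> UNIV) f"
    by (intro continuous_on_open_UN) (auto intro: open_Times Discrete_Topology.open_discrete)
  moreover have "(\<Union>i\<in>UNIV. {i} \<times> UNIV) = (UNIV :: ('i discrete \<times> 'b) set)" by auto
  ultimately show "continuous_on UNIV f" by simp
qed

text \<open>The row sums bound the operator norm of \<open>E - I\<close> for the maximum norm by
  1/2. The equation at the index where \<open>norm (c i)\<close> is largest then gives
  \<open>K \<le> Q + K / 2\<close>. With \<open>Q = 0\<close> this is uniqueness for the linear
  system; with small \<open>Q\<close> it makes the coefficients small.\<close>

lemma near_identity_bound:
  fixes E :: "nat \<Rightarrow> nat \<Rightarrow> complex"
  assumes E: "\<And>j. j < N \<Longrightarrow> (\<Sum>i<N. norm (E j i - (if i = j then 1 else 0))) \<le> 1/2"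
    and eq: "\<And>j. j < N \<Longrightarrow> (\<Sum>i<N. c i * E j i) = q j"
    and q: "\<And>j. j < N \<Longrightarrow> norm (q j) \<le> Q" and i: "i < N"
  shows "norm (c i) \<le> 2 * Q"
proof -
  define K where "K = Max ((\<lambda>i. norm (c i)) ` {..<N})"
  have K: "norm (c i) \<le> K" if "i < N" for i unfolding K_def using that by (intro Max_ge) auto
  have "K \<in> (\<lambda>i. norm (c i)) ` {..<N}" unfolding K_def using i by (intro Max_in) auto
  then obtain j where j: "j < N" "K = norm (c j)" by auto
  have "(\<Sum>i<N. c i * E j i) = (\<Sum>i<N. c i * (E j i - (if i = j then 1 else 0))) + (\<Sum>i<N. if i = j then c i else 0)"
    unfolding sum.distrib[symmetric] by (intro sum.cong) (auto simp: algebra_simps)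
  then have "c j = q j - (\<Sum>i<N. c i * (E j i - (if i = j then 1 else 0)))"
    using eq j by (simp add: sum.delta)
  then have "norm (c j) \<le> norm (q j) + norm (\<Sum>i<N. c i * (E j i - (if i = j then 1 else 0)))"
    by (metis norm_triangle_ineq4)
  also have "norm (\<Sum>i<N. c i * (E j i - (if i = j then 1 else 0))) \<le> (\<Sum>i<N. K * norm (E j i - (if i = j then 1 else 0)))"
    by (intro order_trans[OF norm_sum] sum_mono) (use K in \<open>auto simp: norm_mult intro!: mult_right_mono\<close>)
  also have "\<dots> \<le> K * (1/2)"
    unfolding sum_distrib_left[symmetric] using E[OF j(1)] j by (intro mult_left_mono) auto
  finally have "K \<le> Q + K / 2" using q[OF j(1)] j by simp
  then show ?thesis using K[OF i] by simp
qed

text \<open>The system reads \<open>c + T c = q\<close> with \<open>T\<close> of norm at most 1/2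
  for the maximum norm.\<close>

lemma near_identity_solvable:
  fixes E :: "nat \<Rightarrow> nat \<Rightarrow> complex"
  assumes E: "\<And>j. j < N \<Longrightarrow> (\<Sum>i<N. norm (E j i - (if i = j then 1 else 0))) \<le> 1/2"
  shows "\<exists>c. \<forall>j<N. (\<Sum>i<N. c i * E j i) = q j"
proof -
  \<comment> \<open>Extension of a vector of length \<open>N\<close> by zero, which makes it an
    element of a complete space of bounded continuous functions.\<close>
  define F where "F f = (\<lambda>d. if of_discrete d < N then f (of_discrete d) else 0)" for f :: "nat \<Rightarrow> complex"
  have F: "F f \<in> bcontfun" for f
  proof (rule bcontfun_normI)
    have "continuous_on UNIV (F f)"
      unfolding continuous_on_open_invariant by (metis Discrete_Topology.open_discrete inf_top_right)
    then show "continuous_on UNIV (F f)" .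
    show "norm (F f d) \<le> (\<Sum>i<N. norm (f i))" for d
      using member_le_sum[of "of_discrete d" "{..<N}" "\<lambda>i. norm (f i)"] by (auto simp: F_def intro: sum_nonneg)
  qed
  define T where "T v = Bcontfun (F (\<lambda>j. \<Sum>i<N. apply_bcontfun v (discrete i) * (E j i - (if i = j then 1 else 0))))"
    for v :: "nat discrete \<Rightarrow>\<^sub>C complex"
  have T: "apply_bcontfun (T v) = F (\<lambda>j. \<Sum>i<N. apply_bcontfun v (discrete i) * (E j i - (if i = j then 1 else 0)))" for v
    unfolding T_def by (rule Bcontfun_inverse[OF F])
  have Tdiff: "T (v - v') = T v - T v'" for v v'
    by (rule bcontfun_eqI) (simp add: T F_def left_diff_distrib sum_subtractf)
  have "norm (apply_bcontfun (T v) d) \<le> 1/2 * norm v" for v d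
  proof (cases "of_discrete d < N")
    case True
    let ?j = "of_discrete d"
    have "norm (apply_bcontfun (T v) d) \<le> (\<Sum>i<N. norm v * norm (E ?j i - (if i = ?j then 1 else 0)))"
      using True unfolding T F_def
      by (auto simp: norm_mult intro!: order_trans[OF norm_sum] sum_mono mult_right_mono norm_bounded)
    also have "\<dots> \<le> norm v * (1/2)"
      unfolding sum_distrib_left[symmetric] using E[OF True] by (intro mult_left_mono) auto
    finally show ?thesis by simp
  qed (simp add: T F_def)
  then have Tb: "norm (T v) \<le> 1/2 * norm v" for v by (intro norm_bound) auto
  have "\<exists>v. v + T v = Bcontfun (F q)"
    by (rule id_plus_contraction_surj[where c = "1/2"]) (use Tdiff Tb in auto)
  then obtain v where v: "v + T v = Bcontfun (F q)" ..
  define c where "c i = apply_bcontfun v (discrete i)" for i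
  have "(\<Sum>i<N. c i * E j i) = q j" if "j < N" for j
  proof -
    have "c j + (\<Sum>i<N. c i * (E j i - (if i = j then 1 else 0))) = q j"
      using arg_cong[OF v, of "\<lambda>f. apply_bcontfun f (discrete j)"] Bcontfun_inverse[OF F] that
      by (simp add: T F_def discrete_inverse c_def)
    moreover have "(\<Sum>i<N. c i * E j i) = (\<Sum>i<N. c i * (E j i - (if i = j then 1 else 0))) + (\<Sum>i<N. if i = j then c i else 0)"
      unfolding sum.distrib[symmetric] by (intro sum.cong) (auto simp: algebra_simps)
    ultimately show ?thesis using that by (simp add: sum.delta add.commute)
  qed
  then show ?thesis by blast
qed

locale compact_interval =
  fixes a b :: real
  assumes ab: "a < b"
begin

subsection \<open>Functions of class \<open>C\<^sup>l\<close> on a compact interval\<close>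

text \<open>\<open>hderiv\<close> differentiates on the outside. The inductions below peel off the
  first derivative instead, with the function generalised.\<close>

lemma hderiv_Suc_shift: "hderiv a b (Suc j) x = hderiv a b j (hderiv a b 1 x)"
  by (induction j) simp_all

lemma hderiv_add_index: "hderiv a b (i + j) x = hderiv a b i (hderiv a b j x)"
  by (induction i) simp_all

text \<open>Derivatives are taken within the interval, so values elsewhere have no influence, even
  at the endpoints.\<close>

lemma hderiv_cong:
  assumes "\<And>t. t \<in> {a..b} \<Longrightarrow> x t = w t" and "t \<in> {a..b}"
  shows "hderiv a b j x t = hderiv a b j w t"
  using assms(2)
proof (induction j arbitrary: t)
  case 0
  then show ?case using assms by simp
next
  case (Suc j)
  have "(hderiv a b j x has_vector_derivative d) (at t within {a..b}) \<longleftrightarrow>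
        (hderiv a b j w has_vector_derivative d) (at t within {a..b})" for d
    using Suc by (metis has_vector_derivative_transform)
  then show ?case by (simp add: vector_derivative_def)
qed

text \<open>As \<open>a < b\<close>, derivatives within the interval are unique, including the
  one-sided ones at the endpoints.\<close>

lemma hderiv_1_eq:
  assumes "(x has_vector_derivative d) (at t within {a..b})" and "t \<in> {a..b}"
  shows "hderiv a b 1 x t = d"
  using vector_derivative_within_closed_interval[OF ab assms(2,1)] by simp

lemma Cl_0: "Cl a b 0 x \<longleftrightarrow> continuous_on {a..b} x"
  by (simp add: Cl_def)

text \<open>The recursive form of \<open>Cl\<close>, on which all inductions over the order of
  smoothness rest.\<close>

lemma Cl_Suc:
  "Cl a b (Suc l) x \<longleftrightarrow>
    (\<forall>t\<in>{a..b}. (x has_vector_derivative hderiv a b 1 x t) (at t within {a..b})) \<and>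
    Cl a b l (hderiv a b 1 x)"
  (is "?L \<longleftrightarrow> ?R")
proof
  assume L: ?L
  have "(hderiv a b j (hderiv a b 1 x) has_vector_derivative hderiv a b (Suc j) (hderiv a b 1 x) t)
          (at t within {a..b})" if "j < l" "t \<in> {a..b}" for j t
    using L that unfolding Cl_def hderiv_Suc_shift[symmetric] by blast
  moreover have "continuous_on {a..b} (hderiv a b j (hderiv a b 1 x))" if "j \<le> l" for j
    using L that unfolding Cl_def hderiv_Suc_shift[symmetric] by blast
  moreover have "\<forall>t\<in>{a..b}. (x has_vector_derivative hderiv a b 1 x t) (at t within {a..b})"
    using L unfolding Cl_def by (metis One_nat_def hderiv.simps(1) zero_less_Suc)
  ultimately show ?R by (simp add: Cl_def)
next
  assume R: ?R
  have "(hderiv a b j x has_vector_derivative hderiv a b (Suc j) x t) (at t within {a..b})"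
    if "j < Suc l" "t \<in> {a..b}" for j t
  proof (cases j)
    case 0
    then show ?thesis using R that by simp
  next
    case (Suc i)
    then show ?thesis
      using R that unfolding Cl_def by (metis Suc_less_eq hderiv_Suc_shift)
  qed
  moreover have "continuous_on {a..b} (hderiv a b j x)" if "j \<le> Suc l" for j
  proof (cases j)
    case 0
    then show ?thesis using R
      by (auto simp: continuous_on_eq_continuous_within intro: has_vector_derivative_continuous)
  next
    case (Suc i)
    then show ?thesis using R that unfolding Cl_def by (metis Suc_le_mono hderiv_Suc_shift)
  qed
  ultimately show ?L unfolding Cl_def by blast
qed

lemma Cl_cong:
  assumes "\<And>t. t \<in> {a..b} \<Longrightarrow> x t = w t"
  shows "Cl a b l x \<longleftrightarrow> Cl a b l w"
proof -
  have eq: "hderiv a b j x t = hderiv a b j w t" if "t \<in> {a..b}" for j t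
    by (rule hderiv_cong[OF _ that]) (rule assms)
  have "(hderiv a b j x has_vector_derivative hderiv a b (Suc j) x t) (at t within {a..b}) \<longleftrightarrow>
        (hderiv a b j w has_vector_derivative hderiv a b (Suc j) w t) (at t within {a..b})"
    if "t \<in> {a..b}" for j t
    using eq that by (metis has_vector_derivative_transform)
  moreover have "continuous_on {a..b} (hderiv a b j x) \<longleftrightarrow> continuous_on {a..b} (hderiv a b j w)" for j
    using eq continuous_on_cong by blast
  ultimately show ?thesis unfolding Cl_def by blast
qed

lemma hderiv_SucI:
  assumes "\<And>t. t \<in> {a..b} \<Longrightarrow> (x has_vector_derivative x' t) (at t within {a..b})"
    and "t \<in> {a..b}"
  shows "hderiv a b (Suc j) x t = hderiv a b j x' t"
  unfolding hderiv_Suc_shift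
  by (rule hderiv_cong) (use assms hderiv_1_eq in blast)+

lemma Cl_SucI:
  assumes "\<And>t. t \<in> {a..b} \<Longrightarrow> (x has_vector_derivative x' t) (at t within {a..b})"
    and "Cl a b l x'"
  shows "Cl a b (Suc l) x"
proof -
  have eq: "hderiv a b 1 x t = x' t" if "t \<in> {a..b}" for t
    using assms(1) hderiv_1_eq that by blast
  then show ?thesis
    unfolding Cl_Suc using assms Cl_cong[of "hderiv a b 1 x" x'] by metis
qed

lemma Cl_mono: "Cl a b l x \<Longrightarrow> k \<le> l \<Longrightarrow> Cl a b k x"
  unfolding Cl_def by auto

lemma Cl_hderiv:
  assumes "Cl a b l x" and "k + s \<le> l"
  shows "Cl a b k (hderiv a b s x)"
proof -
  have "hderiv a b j (hderiv a b s x) = hderiv a b (j + s) x" for j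
    by (simp add: hderiv_add_index)
  moreover have "hderiv a b (Suc j) (hderiv a b s x) = hderiv a b (Suc (j + s)) x" for j
    using hderiv_add_index[of "Suc j" s x] by simp
  ultimately show ?thesis
    using assms unfolding Cl_def by simp
qed

lemma continuous_on_hderiv: "Cl a b l x \<Longrightarrow> j \<le> l \<Longrightarrow> continuous_on {a..b} (hderiv a b j x)"
  unfolding Cl_def by blast

lemma continuous_on_Cl: "Cl a b l x \<Longrightarrow> continuous_on {a..b} x"
  unfolding Cl_def by (metis hderiv.simps(1) le0)

section \<open>Linear combinations and products of functions of class
  \<open>C\<^sup>l\<close>\<close>

lemma Cl_hderiv_add:
  assumes "Cl a b l x" and "Cl a b l w"
  shows "Cl a b l (\<lambda>t. x t + w t) \<and>
    (\<forall>j\<le>l. \<forall>t\<in>{a..b}. hderiv a b j (\<lambda>t. x t + w t) t = hderiv a b j x t + hderiv a b j w t)"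
  using assms
proof (induction l arbitrary: x w)
  case 0
  then show ?case by (auto simp: Cl_0 intro: continuous_on_add)
next
  case (Suc l)
  let ?x' = "hderiv a b 1 x" and ?w' = "hderiv a b 1 w"
  have IH: "Cl a b l (\<lambda>t. ?x' t + ?w' t) \<and> (\<forall>j\<le>l. \<forall>t\<in>{a..b}.
      hderiv a b j (\<lambda>t. ?x' t + ?w' t) t = hderiv a b j ?x' t + hderiv a b j ?w' t)"
    using Suc.prems unfolding Cl_Suc by (intro Suc.IH) auto
  have d: "((\<lambda>t. x t + w t) has_vector_derivative ?x' t + ?w' t) (at t within {a..b})"
    if "t \<in> {a..b}" for t
    using Suc.prems that unfolding Cl_Suc by (blast intro: has_vector_derivative_add)
  have "hderiv a b j (\<lambda>t. x t + w t) t = hderiv a b j x t + hderiv a b j w t"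
    if "j \<le> Suc l" "t \<in> {a..b}" for j t
  proof (cases j)
    case (Suc i)
    then show ?thesis
      using hderiv_SucI[OF d that(2), of i] IH that
      by (simp only: hderiv_Suc_shift[of i x] hderiv_Suc_shift[of i w] Suc_le_mono)
  qed simp
  then show ?case using Cl_SucI[OF d] IH by blast
qed

lemma Cl_hderiv_cmult:
  assumes "Cl a b l x"
  shows "Cl a b l (\<lambda>t. c * x t) \<and>
    (\<forall>j\<le>l. \<forall>t\<in>{a..b}. hderiv a b j (\<lambda>t. c * x t) t = c * hderiv a b j x t)"
  using assms
proof (induction l arbitrary: x)
  case 0
  then show ?case by (auto simp: Cl_0 intro!: continuous_intros)
next
  case (Suc l)
  let ?x' = "hderiv a b 1 x"
  have IH: "Cl a b l (\<lambda>t. c * ?x' t) \<and> (\<forall>j\<le>l. \<forall>t\<in>{a..b}.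
      hderiv a b j (\<lambda>t. c * ?x' t) t = c * hderiv a b j ?x' t)"
    using Suc.prems unfolding Cl_Suc by (intro Suc.IH) auto
  have d: "((\<lambda>t. c * x t) has_vector_derivative c * ?x' t) (at t within {a..b})"
    if "t \<in> {a..b}" for t
    using Suc.prems that unfolding Cl_Suc by (blast intro: has_vector_derivative_mult_right)
  have "hderiv a b j (\<lambda>t. c * x t) t = c * hderiv a b j x t"
    if "j \<le> Suc l" "t \<in> {a..b}" for j t
  proof (cases j)
    case (Suc i)
    then show ?thesis
      using hderiv_SucI[OF d that(2), of i] IH that
      by (simp only: hderiv_Suc_shift[of i x] Suc_le_mono)
  qed simp
  then show ?case using Cl_SucI[OF d] IH by blast
qed

lemmas Cl_add = Cl_hderiv_add[THEN conjunct1]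
lemmas Cl_cmult = Cl_hderiv_cmult[THEN conjunct1]

lemma hderiv_add:
  "Cl a b l x \<Longrightarrow> Cl a b l w \<Longrightarrow> j \<le> l \<Longrightarrow> t \<in> {a..b} \<Longrightarrow>
    hderiv a b j (\<lambda>t. x t + w t) t = hderiv a b j x t + hderiv a b j w t"
  using Cl_hderiv_add by blast

lemma hderiv_cmult:
  "Cl a b l x \<Longrightarrow> j \<le> l \<Longrightarrow> t \<in> {a..b} \<Longrightarrow> hderiv a b j (\<lambda>t. c * x t) t = c * hderiv a b j x t"
  using Cl_hderiv_cmult by blast

lemma Cl_diff: "Cl a b l x \<Longrightarrow> Cl a b l w \<Longrightarrow> Cl a b l (\<lambda>t. x t - w t)"
  using Cl_add[OF _ Cl_cmult[of l w "-1"], of x] by simp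

lemma hderiv_diff:
  "Cl a b l x \<Longrightarrow> Cl a b l w \<Longrightarrow> j \<le> l \<Longrightarrow> t \<in> {a..b} \<Longrightarrow>
    hderiv a b j (\<lambda>t. x t - w t) t = hderiv a b j x t - hderiv a b j w t"
  using hderiv_add[OF _ Cl_cmult[of l w "-1"], of x j t] hderiv_cmult[of l w j t "-1"] by simp

lemma Cl_hderiv_zero: "Cl a b l (\<lambda>t. 0) \<and> (\<forall>t\<in>{a..b}. hderiv a b j (\<lambda>t. 0) t = 0)"
proof -
  have "Cl a b l (\<lambda>t. 0)" for l
  proof (induction l)
    case (Suc l)
    show ?case by (rule Cl_SucI[OF _ Suc]) simp
  qed (simp add: Cl_0)
  then show ?thesis using hderiv_cmult[of j "\<lambda>t. 0" j _ 0] by auto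
qed

lemmas Cl_zero = Cl_hderiv_zero[THEN conjunct1]

lemma hderiv_zero: "t \<in> {a..b} \<Longrightarrow> hderiv a b j (\<lambda>t. 0) t = 0"
  using Cl_hderiv_zero by blast

lemma Cl_const: "Cl a b l (\<lambda>t. c)"
proof (cases l)
  case (Suc k)
  show ?thesis unfolding Suc by (rule Cl_SucI[OF _ Cl_zero]) simp
qed (simp add: Cl_0)

lemma Cl_hderiv_sum:
  assumes "finite S" and "\<And>i. i \<in> S \<Longrightarrow> Cl a b l (x i)"
  shows "Cl a b l (\<lambda>t. \<Sum>i\<in>S. x i t) \<and>
    (\<forall>j\<le>l. \<forall>t\<in>{a..b}. hderiv a b j (\<lambda>t. \<Sum>i\<in>S. x i t) t = (\<Sum>i\<in>S. hderiv a b j (x i) t))"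
  using assms
proof (induction S rule: finite_induct)
  case (insert i S)
  then have C: "Cl a b l (x i)" "Cl a b l (\<lambda>t. \<Sum>i\<in>S. x i t)" by auto
  show ?case using insert Cl_add[OF C] hderiv_add[OF C] by simp
qed (simp add: Cl_zero hderiv_zero)

lemma Cl_sum: "(\<And>i. i \<in> S \<Longrightarrow> Cl a b l (x i)) \<Longrightarrow> Cl a b l (\<lambda>t. \<Sum>i\<in>S. x i t)"
  using Cl_hderiv_sum[of S l x] Cl_zero by (cases "finite S") auto

lemma hderiv_sum:
  "(\<And>i. i \<in> S \<Longrightarrow> Cl a b l (x i)) \<Longrightarrow> j \<le> l \<Longrightarrow> t \<in> {a..b} \<Longrightarrow>
    hderiv a b j (\<lambda>t. \<Sum>i\<in>S. x i t) t = (\<Sum>i\<in>S. hderiv a b j (x i) t)"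
  using Cl_hderiv_sum[of S l x] hderiv_zero by (cases "finite S") auto

lemma Cl_mult:
  assumes "Cl a b l x" and "Cl a b l w"
  shows "Cl a b l (\<lambda>t. x t * w t)"
  using assms
proof (induction l arbitrary: x w)
  case 0
  then show ?case by (auto simp: Cl_0 intro: continuous_on_mult)
next
  case (Suc l)
  show ?case
  proof (rule Cl_SucI)
    show "((\<lambda>t. x t * w t) has_vector_derivative x t * hderiv a b 1 w t + hderiv a b 1 x t * w t)
        (at t within {a..b})" if "t \<in> {a..b}" for t
      using Suc.prems that unfolding Cl_Suc by (blast intro: has_vector_derivative_mult)
    have "Cl a b l x" "Cl a b l w" using Suc.prems Cl_mono by (meson le_SucI order_refl)+
    then show "Cl a b l (\<lambda>t. x t * hderiv a b 1 w t + hderiv a b 1 x t * w t)"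
      using Suc.prems unfolding Cl_Suc by (intro Cl_add Suc.IH) auto
  qed
qed

lemma hderiv_1_mult:
  assumes "Cl a b (Suc l) x" and "Cl a b (Suc l) w" and "t \<in> {a..b}"
  shows "hderiv a b 1 (\<lambda>t. x t * w t) t = x t * hderiv a b 1 w t + hderiv a b 1 x t * w t"
  using assms unfolding Cl_Suc by (intro hderiv_1_eq has_vector_derivative_mult) auto

section \<open>Estimates for the norm of \<open>C\<^sup>l\<close>\<close>

lemma cnorm_Suc: "cnorm a b (Suc l) x = cnorm a b 0 x + cnorm a b l (hderiv a b 1 x)"
  unfolding cnorm_def sum.atMost_Suc_shift hderiv_Suc_shift by simp

lemma cnorm_cong: "(\<And>t. t \<in> {a..b} \<Longrightarrow> x t = w t) \<Longrightarrow> cnorm a b l x = cnorm a b l w"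
  unfolding cnorm_def using hderiv_cong[of x w] by (metis (no_types, lifting) image_cong)

lemma norm_le_cnorm_0:
  assumes "continuous_on {a..b} x" and "t \<in> {a..b}"
  shows "norm (x t) \<le> cnorm a b 0 x"
proof -
  have "compact ((\<lambda>t. norm (x t)) ` {a..b})"
    by (intro compact_continuous_image continuous_on_norm assms(1) compact_Icc)
  then have "bdd_above ((\<lambda>t. norm (x t)) ` {a..b})"
    by (simp add: bounded_imp_bdd_above compact_imp_bounded)
  then show ?thesis using cSUP_upper[OF assms(2)] by (simp add: cnorm_def)
qed

lemma cnorm_0_le:
  assumes "\<And>t. t \<in> {a..b} \<Longrightarrow> norm (x t) \<le> K"
  shows "cnorm a b 0 x \<le> K"
  using ab assms by (auto simp: cnorm_def intro!: cSUP_least)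

lemma cnorm_0_nonneg: "continuous_on {a..b} x \<Longrightarrow> 0 \<le> cnorm a b 0 x"
  using norm_le_cnorm_0[of x a] ab by (meson atLeastAtMost_iff less_eq_real_def norm_ge_zero order_trans)

lemma cnorm_nonneg: "Cl a b l x \<Longrightarrow> 0 \<le> cnorm a b l x"
proof (induction l arbitrary: x)
  case (Suc l)
  then show ?case using continuous_on_Cl[OF Suc.prems] cnorm_0_nonneg
    unfolding cnorm_Suc Cl_Suc by (simp add: add_nonneg_nonneg)
qed (simp add: Cl_0 cnorm_0_nonneg)

lemma cnorm_mono:
  assumes "Cl a b l x" and "k \<le> l"
  shows "cnorm a b k x \<le> cnorm a b l x"
  using assms
proof (induction k arbitrary: l x)
  case 0
  then show ?case
  proof (cases l)
    case (Suc l')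
    then show ?thesis using 0 cnorm_nonneg[of l' "hderiv a b 1 x"] unfolding Suc cnorm_Suc Cl_Suc by simp
  qed simp
next
  case (Suc k)
  then obtain l' where "l = Suc l'" "k \<le> l'" by (metis Suc_le_D Suc_le_mono)
  then show ?case using Suc.IH[of l' "hderiv a b 1 x"] Suc.prems unfolding cnorm_Suc by (simp only: cnorm_Suc Cl_Suc add_left_mono)
qed

lemma cnorm_hderiv_le:
  assumes "Cl a b l x" and "k + s \<le> l"
  shows "cnorm a b k (hderiv a b s x) \<le> cnorm a b l x"
  using assms
proof (induction s arbitrary: l x)
  case 0
  then show ?case by (simp add: cnorm_mono)
next
  case (Suc s)
  then obtain l' where l: "l = Suc l'" "k + s \<le> l'"
    by (metis Suc_le_D Suc_le_mono add_Suc_right)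
  have "cnorm a b k (hderiv a b s (hderiv a b 1 x)) \<le> cnorm a b l' (hderiv a b 1 x)"
    using Suc.IH[of l' "hderiv a b 1 x"] Suc.prems l by (simp only: Cl_Suc)
  also have "\<dots> \<le> cnorm a b l x"
    using cnorm_0_nonneg continuous_on_Cl[OF Suc.prems(1)] l by (simp only: cnorm_Suc) simp
  finally show ?case unfolding hderiv_Suc_shift .
qed

lemma norm_hderiv_le_cnorm:
  assumes "Cl a b l x" and "j \<le> l" and "t \<in> {a..b}"
  shows "norm (hderiv a b j x t) \<le> cnorm a b l x"
  using norm_le_cnorm_0[OF continuous_on_hderiv[OF assms(1,2)] assms(3)]
    cnorm_hderiv_le[of l x 0 j] assms by simp

lemma cnorm_add_le:
  assumes "Cl a b l x" and "Cl a b l w"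
  shows "cnorm a b l (\<lambda>t. x t + w t) \<le> cnorm a b l x + cnorm a b l w"
  using assms
proof (induction l arbitrary: x w)
  case 0
  show ?case
  proof (rule cnorm_0_le)
    fix t assume "t \<in> {a..b}"
    then show "norm (x t + w t) \<le> cnorm a b 0 x + cnorm a b 0 w"
      using 0 norm_le_cnorm_0[of x t] norm_le_cnorm_0[of w t] norm_triangle_ineq[of "x t" "w t"]
      by (simp add: Cl_0)
  qed
next
  case (Suc l)
  have "Cl a b 0 x" "Cl a b 0 w" using Suc.prems Cl_mono by blast+
  then have "cnorm a b 0 (\<lambda>t. x t + w t) \<le> cnorm a b 0 x + cnorm a b 0 w"
    by (intro cnorm_0_le order_trans[OF norm_triangle_ineq] add_mono norm_le_cnorm_0) (auto simp: Cl_0)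
  moreover have "cnorm a b l (hderiv a b 1 (\<lambda>t. x t + w t)) =
      cnorm a b l (\<lambda>t. hderiv a b 1 x t + hderiv a b 1 w t)"
    by (rule cnorm_cong) (rule hderiv_add[OF Suc.prems], auto)
  moreover have "\<dots> \<le> cnorm a b l (hderiv a b 1 x) + cnorm a b l (hderiv a b 1 w)"
    using Suc unfolding Cl_Suc by blast
  ultimately show ?case unfolding cnorm_Suc by linarith
qed

lemma cnorm_cmult_le:
  assumes "Cl a b l x"
  shows "cnorm a b l (\<lambda>t. c * x t) \<le> norm c * cnorm a b l x"
  using assms
proof (induction l arbitrary: x)
  case 0
  show ?case
    by (rule cnorm_0_le) (use 0 in \<open>auto simp: Cl_0 norm_mult intro!: mult_left_mono norm_le_cnorm_0\<close>)
next
  case (Suc l)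
  have "cnorm a b 0 (\<lambda>t. c * x t) \<le> norm c * cnorm a b 0 x"
    by (rule cnorm_0_le)
      (use continuous_on_Cl[OF Suc.prems] in \<open>auto simp: norm_mult intro!: mult_left_mono norm_le_cnorm_0\<close>)
  moreover have "cnorm a b l (hderiv a b 1 (\<lambda>t. c * x t)) = cnorm a b l (\<lambda>t. c * hderiv a b 1 x t)"
    by (rule cnorm_cong) (rule hderiv_cmult[OF Suc.prems], auto)
  moreover have "\<dots> \<le> norm c * cnorm a b l (hderiv a b 1 x)"
    using Suc unfolding Cl_Suc by blast
  ultimately show ?case unfolding cnorm_Suc distrib_left by linarith
qed

lemma cnorm_diff_le:
  assumes "Cl a b l x" and "Cl a b l w"
  shows "cnorm a b l (\<lambda>t. x t - w t) \<le> cnorm a b l x + cnorm a b l w"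
  using cnorm_add_le[OF assms(1) Cl_cmult[OF assms(2), of "-1"]] cnorm_cmult_le[OF assms(2), of "-1"]
  by simp

lemma cnorm_zero: "cnorm a b l (\<lambda>t. 0) = 0"
  using cnorm_cmult_le[OF Cl_zero, of l 0] cnorm_nonneg[OF Cl_zero, of l] by simp

lemma cnorm_sum_le:
  "(\<And>i. i \<in> S \<Longrightarrow> Cl a b l (x i)) \<Longrightarrow> cnorm a b l (\<lambda>t. \<Sum>i\<in>S. x i t) \<le> (\<Sum>i\<in>S. cnorm a b l (x i))"
proof (induction S rule: infinite_finite_induct)
  case (insert i S)
  then show ?case
    using cnorm_add_le[of l "x i" "\<lambda>t. \<Sum>i\<in>S. x i t"] Cl_sum[of S l x] by fastforce
qed (simp_all add: cnorm_zero)

text \<open>Induction with the product rule for the first derivative only. Each order costs at most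
  a factor 2, so no binomial coefficients are needed.\<close>

lemma cnorm_mult_le:
  assumes "Cl a b l x" and "Cl a b l w"
  shows "cnorm a b l (\<lambda>t. x t * w t) \<le> 2 ^ l * cnorm a b l x * cnorm a b l w"
  using assms
proof (induction l arbitrary: x w)
  case 0
  show ?case
    by (rule cnorm_0_le)
      (use 0 in \<open>auto simp: Cl_0 norm_mult intro!: mult_mono norm_le_cnorm_0 cnorm_0_nonneg\<close>)
next
  case (Suc l)
  let ?x' = "hderiv a b 1 x" and ?w' = "hderiv a b 1 w"
  have C: "Cl a b l x" "Cl a b l w" "Cl a b l ?x'" "Cl a b l ?w'"
    using Suc.prems Cl_mono[of "Suc l"] by (auto simp: Cl_Suc)
  have cont: "continuous_on {a..b} x" "continuous_on {a..b} w"
    using Suc.prems continuous_on_Cl by blast+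
  note nn = cnorm_0_nonneg[OF cont(1)] cnorm_0_nonneg[OF cont(2)] cnorm_nonneg[OF C(3)] cnorm_nonneg[OF C(4)]
  have 0: "cnorm a b 0 (\<lambda>t. x t * w t) \<le> cnorm a b 0 x * cnorm a b 0 w"
    by (rule cnorm_0_le) (auto simp: norm_mult intro!: mult_mono norm_le_cnorm_0 cont nn)
  have "cnorm a b l (hderiv a b 1 (\<lambda>t. x t * w t)) = cnorm a b l (\<lambda>t. x t * ?w' t + ?x' t * w t)"
    by (rule cnorm_cong) (rule hderiv_1_mult[OF Suc.prems])
  also have "\<dots> \<le> cnorm a b l (\<lambda>t. x t * ?w' t) + cnorm a b l (\<lambda>t. ?x' t * w t)"
    by (intro cnorm_add_le Cl_mult C)
  also have "\<dots> \<le> 2 ^ l * cnorm a b l x * cnorm a b l ?w' + 2 ^ l * cnorm a b l ?x' * cnorm a b l w"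
    by (intro add_mono Suc.IH C)
  also have "\<dots> \<le> 2 ^ l * cnorm a b (Suc l) x * cnorm a b l ?w' + 2 ^ l * cnorm a b l ?x' * cnorm a b (Suc l) w"
    by (intro add_mono mult_left_mono mult_right_mono cnorm_mono Suc.prems nn) (use nn in auto)
  finally have 1: "cnorm a b l (hderiv a b 1 (\<lambda>t. x t * w t)) \<le>
     2 ^ l * (cnorm a b (Suc l) x * cnorm a b l ?w' + cnorm a b l ?x' * cnorm a b (Suc l) w)"
    by (simp add: algebra_simps)
  have "cnorm a b 0 x * cnorm a b 0 w \<le> 2 ^ l * (cnorm a b 0 x * cnorm a b 0 w)"
    using nn mult_right_mono[of 1 "2 ^ l" "cnorm a b 0 x * cnorm a b 0 w"] by simp
  then have "cnorm a b (Suc l) (\<lambda>t. x t * w t) \<le>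
     2 ^ l * (cnorm a b 0 x * cnorm a b 0 w + cnorm a b (Suc l) x * cnorm a b l ?w' + cnorm a b l ?x' * cnorm a b (Suc l) w)"
    using 0 1 unfolding cnorm_Suc[of l "\<lambda>t. x t * w t"] by (simp add: distrib_left)
  also have "\<dots> \<le> 2 ^ l * (2 * (cnorm a b (Suc l) x * cnorm a b (Suc l) w))"
  proof (rule mult_left_mono)
    \<comment> \<open>With both full norms split into order 0 and the norm of the derivative, the
      left side is their product plus the single extra term
      \<open>cnorm a b l ?x' * cnorm a b l ?w'\<close>.\<close>
    show "cnorm a b 0 x * cnorm a b 0 w + cnorm a b (Suc l) x * cnorm a b l ?w' + cnorm a b l ?x' * cnorm a b (Suc l) w
      \<le> 2 * (cnorm a b (Suc l) x * cnorm a b (Suc l) w)"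
      using nn unfolding cnorm_Suc by (simp add: algebra_simps)
  qed simp
  finally show ?case by (simp add: algebra_simps)
qed

subsection \<open>Iterated primitives\<close>

text \<open>The value 0 outside the interval lets iterated primitives meet the normalisation of
  \<open>Cvec\<close>.\<close>

definition prim :: "(real \<Rightarrow> complex) \<Rightarrow> real \<Rightarrow> complex" where
  "prim x t = (if t \<in> {a..b} then integral {a..t} x else 0)"

lemma prim_has_vector_derivative:
  assumes "continuous_on {a..b} x" and "t \<in> {a..b}"
  shows "(prim x has_vector_derivative x t) (at t within {a..b})"
  using integral_has_vector_derivative[OF assms]
  by (rule has_vector_derivative_transform[OF assms(2), rotated]) (simp add: prim_def)

lemma prim_at_left [simp]: "prim x a = 0"
  by (simp add: prim_def)

lemma prim_outside: "t \<notin> {a..b} \<Longrightarrow> prim x t = 0"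
  by (auto simp: prim_def)

lemma prim_cong: "(\<And>t. t \<in> {a..b} \<Longrightarrow> x t = w t) \<Longrightarrow> prim x = prim w"
  by (auto simp: prim_def fun_eq_iff intro!: integral_cong)

lemma Cl_prim: "Cl a b l x \<Longrightarrow> Cl a b (Suc l) (prim x)"
  using Cl_SucI prim_has_vector_derivative continuous_on_Cl by blast

lemma hderiv_Suc_prim:
  "continuous_on {a..b} x \<Longrightarrow> t \<in> {a..b} \<Longrightarrow> hderiv a b (Suc j) (prim x) t = hderiv a b j x t"
  using hderiv_SucI prim_has_vector_derivative by blast

lemma norm_prim_le:
  assumes "continuous_on {a..b} x" and "t \<in> {a..b}" and "\<And>s. s \<in> {a..b} \<Longrightarrow> norm (x s) \<le> K"
  shows "norm (prim x t) \<le> (b - a) * K"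
proof -
  have "0 \<le> K" using assms(2,3) norm_ge_zero order_trans by blast
  have "norm (integral {a..t} x) \<le> K * (t - a)"
    by (rule integral_bound) (use assms continuous_on_subset[OF assms(1), of "{a..t}"] in auto)
  also have "\<dots> \<le> (b - a) * K" using assms(2) \<open>0 \<le> K\<close> by (simp add: mult.commute[of K] mult_right_mono)
  finally show ?thesis using assms(2) by (simp add: prim_def)
qed

lemma cnorm_prim_le:
  assumes "Cl a b l x"
  shows "cnorm a b (Suc l) (prim x) \<le> (1 + (b - a)) * cnorm a b l x"
proof -
  have cont: "continuous_on {a..b} x" using assms continuous_on_Cl by blast
  have "cnorm a b 0 (prim x) \<le> (b - a) * cnorm a b 0 x"
    by (intro cnorm_0_le norm_prim_le norm_le_cnorm_0 cont)
  also have "\<dots> \<le> (b - a) * cnorm a b l x"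
    using ab assms by (intro mult_left_mono cnorm_mono) auto
  finally have "cnorm a b 0 (prim x) \<le> (b - a) * cnorm a b l x" .
  moreover have "cnorm a b l (hderiv a b 1 (prim x)) = cnorm a b l x"
    using hderiv_Suc_prim[OF cont, of _ 0] by (intro cnorm_cong) simp
  ultimately show ?thesis unfolding cnorm_Suc by (simp add: algebra_simps)
qed

lemma Cl_prim_pow: "Cl a b l x \<Longrightarrow> Cl a b (l + i) ((prim ^^ i) x)"
  by (induction i) (simp_all add: Cl_prim)

lemma continuous_on_prim_pow: "continuous_on {a..b} x \<Longrightarrow> continuous_on {a..b} ((prim ^^ i) x)"
  using Cl_prim_pow[of 0 x i] continuous_on_Cl by (simp add: Cl_0)

lemma cnorm_prim_pow_le:
  assumes "Cl a b l x"
  shows "cnorm a b (l + i) ((prim ^^ i) x) \<le> (1 + (b - a)) ^ i * cnorm a b l x"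
proof (induction i)
  case (Suc i)
  have "cnorm a b (l + Suc i) ((prim ^^ Suc i) x) \<le> (1 + (b - a)) * cnorm a b (l + i) ((prim ^^ i) x)"
    using cnorm_prim_le[OF Cl_prim_pow[OF assms, of i]] by simp
  also have "\<dots> \<le> (1 + (b - a)) * ((1 + (b - a)) ^ i * cnorm a b l x)"
    using Suc ab by (intro mult_left_mono) auto
  finally show ?case by (simp add: mult.assoc)
qed simp

lemma hderiv_prim_pow:
  assumes "continuous_on {a..b} x" and "t \<in> {a..b}"
  shows "hderiv a b j ((prim ^^ (j + i)) x) t = (prim ^^ i) x t"
  using assms(2)
proof (induction j arbitrary: t)
  case (Suc j)
  then show ?case
    using hderiv_Suc_prim[OF continuous_on_prim_pow[OF assms(1), of "j + i"] Suc.prems, of j] by simp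
qed simp

lemma prim_pow_outside: "0 < i \<Longrightarrow> t \<notin> {a..b} \<Longrightarrow> (prim ^^ i) x t = 0"
  by (cases i) (simp_all add: prim_outside)

lemma prim_pow_at_left: "0 < i \<Longrightarrow> (prim ^^ i) x a = 0"
  by (cases i) simp_all

lemma prim_add:
  "continuous_on {a..b} x \<Longrightarrow> continuous_on {a..b} w \<Longrightarrow> prim (\<lambda>t. x t + w t) = (\<lambda>t. prim x t + prim w t)"
  by (auto simp: prim_def fun_eq_iff intro!: integral_add integrable_continuous_real elim: continuous_on_subset)

lemma prim_cmult: "prim (\<lambda>t. c * x t) = (\<lambda>t. c * prim x t)"
  by (auto simp: prim_def fun_eq_iff)

lemma prim_pow_add:
  "continuous_on {a..b} x \<Longrightarrow> continuous_on {a..b} w \<Longrightarrow>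
    (prim ^^ i) (\<lambda>t. x t + w t) = (\<lambda>t. (prim ^^ i) x t + (prim ^^ i) w t)"
  by (induction i) (simp_all add: prim_add continuous_on_prim_pow)

lemma prim_pow_cmult: "(prim ^^ i) (\<lambda>t. c * x t) = (\<lambda>t. c * (prim ^^ i) x t)"
  by (induction i) (simp_all add: prim_cmult)

lemma prim_pow_diff:
  "continuous_on {a..b} x \<Longrightarrow> continuous_on {a..b} w \<Longrightarrow>
    (prim ^^ i) (\<lambda>t. x t - w t) = (\<lambda>t. (prim ^^ i) x t - (prim ^^ i) w t)"
  using prim_pow_add[of x "\<lambda>t. -1 * w t" i] prim_pow_cmult[of i "-1" w]
  by (simp add: continuous_on_minus)

lemma prim_pow_sum:
  "(\<And>k. k \<in> S \<Longrightarrow> continuous_on {a..b} (x k)) \<Longrightarrow> finite S \<Longrightarrow>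
    (prim ^^ i) (\<lambda>t. \<Sum>k\<in>S. x k t) = (\<lambda>t. \<Sum>k\<in>S. (prim ^^ i) (x k) t)"
proof (induction S rule: infinite_finite_induct)
  case empty
  then show ?case using prim_pow_cmult[of i 0 "\<lambda>t. 0"] by simp
next
  case (insert k S)
  then show ?case
    using prim_pow_add[of "x k" "\<lambda>t. \<Sum>k\<in>S. x k t" i] continuous_on_sum[of S "{a..b}" x] by simp
qed simp

lemma prim_pow_cong:
  "(\<And>t. t \<in> {a..b} \<Longrightarrow> x t = w t) \<Longrightarrow> t \<in> {a..b} \<Longrightarrow> (prim ^^ i) x t = (prim ^^ i) w t"
  using prim_cong[of x w] by (cases i) (simp_all add: funpow_swap1)

lemma eq_left_plus_prim:
  assumes "\<And>t. t \<in> {a..b} \<Longrightarrow> (x has_vector_derivative x' t) (at t within {a..b})"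
    and "t \<in> {a..b}"
  shows "x t = x a + prim x' t"
proof -
  have "(x' has_integral (x t - x a)) {a..t}"
    by (rule fundamental_theorem_of_calculus)
      (use assms has_vector_derivative_within_subset[of x _ _ "{a..b}" "{a..t}"] in auto)
  then show ?thesis using assms(2) by (simp add: prim_def integral_unique)
qed

text \<open>Taylor's formula at \<open>a\<close>: on the interval
  \<open>(prim ^^ l) (\<lambda>_. 1)\<close> is the monomial \<open>(t - a) ^ l / fact l\<close>,
  and the remainder is an iterated primitive. The induction applies the formula to the first
  derivative and integrates once.\<close>

lemma Taylor_prim:
  assumes "Cl a b n x" and "t \<in> {a..b}"
  shows "x t = (\<Sum>l<n. hderiv a b l x a * (prim ^^ l) (\<lambda>_. 1) t) + (prim ^^ n) (hderiv a b n x) t"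
  using assms
proof (induction n arbitrary: x t)
  case (Suc n)
  let ?x' = "hderiv a b 1 x"
  let ?g = "\<lambda>t. (\<Sum>l<n. hderiv a b l ?x' a * (prim ^^ l) (\<lambda>_. 1) t)"
  have one: "continuous_on {a..b} ((prim ^^ l) (\<lambda>_. 1))" for l
    by (rule continuous_on_prim_pow) simp
  have c: "continuous_on {a..b} (hderiv a b n ?x')"
    using Suc.prems unfolding Cl_Suc by (meson continuous_on_hderiv order_refl)
  have "x t = x a + prim ?x' t"
    by (rule eq_left_plus_prim) (use Suc.prems Cl_Suc in blast)+
  also have "prim ?x' = prim (\<lambda>t. ?g t + (prim ^^ n) (hderiv a b n ?x') t)"
    by (rule prim_cong) (use Suc Cl_Suc in blast)
  also have "\<dots> = (\<lambda>t. prim ?g t + prim ((prim ^^ n) (hderiv a b n ?x')) t)"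
    by (intro prim_add continuous_intros one continuous_on_prim_pow c)
  also have "prim ?g = (\<lambda>t. \<Sum>l<n. prim (\<lambda>t. hderiv a b l ?x' a * (prim ^^ l) (\<lambda>_. 1) t) t)"
    using prim_pow_sum[of "{..<n}" "\<lambda>l t. hderiv a b l ?x' a * (prim ^^ l) (\<lambda>_. 1) t" 1]
    by (simp add: continuous_intros one)
  finally show ?case
    using Suc.prems(2)
    unfolding sum.lessThan_Suc_shift hderiv_Suc_shift prim_cmult by (simp add: o_def)
qed simp

lemma eq_prim_pow_hderiv:
  assumes "Cl a b n x" and "\<And>l. l < n \<Longrightarrow> hderiv a b l x a = 0" and "t \<in> {a..b}"
  shows "x t = (prim ^^ n) (hderiv a b n x) t"
  using Taylor_prim[OF assms(1,3)] assms(2) by simp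

subsection \<open>Volterra systems\<close>

text \<open>In the norm with weight \<open>exp (- L * (t - a))\<close>, integration gains a factor
  \<open>1 / L\<close>. Large \<open>L\<close> therefore turns Volterra operators into
  contractions.\<close>

lemma norm_prim_exp_le:
  assumes x: "continuous_on {a..b} x" and L: "0 < L"
    and bound: "\<And>t. t \<in> {a..b} \<Longrightarrow> norm (x t) \<le> K * exp (L * (t - a))" and t: "t \<in> {a..b}"
  shows "norm (prim x t) \<le> K / L * exp (L * (t - a))"
proof -
  have "norm (x t) \<le> K * exp (L * (t - a))" using bound t .
  then have K: "0 \<le> K" by (meson exp_gt_zero norm_ge_zero order_trans zero_le_mult_iff not_le)
  have deriv: "((\<lambda>s. K / L * exp (L * (s - a))) has_vector_derivative K * exp (L * (s - a))) (at s within {a..t})"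
    for s
    using L by (auto intro!: derivative_eq_intros simp: has_real_derivative_iff_has_vector_derivative[symmetric])
  have int: "((\<lambda>s. K * exp (L * (s - a))) has_integral (K / L * exp (L * (t - a)) - K / L * exp (L * (a - a)))) {a..t}"
    by (rule fundamental_theorem_of_calculus) (use t deriv in auto)
  have "norm (integral {a..t} x) \<le> integral {a..t} (\<lambda>s. K * exp (L * (s - a)))"
    by (rule Henstock_Kurzweil_Integration.integral_norm_bound_integral)
      (use t bound has_integral_integrable[OF int] in
        \<open>auto intro!: integrable_continuous_real[OF continuous_on_subset[OF x]]\<close>)
  also have "\<dots> \<le> K / L * exp (L * (t - a))"
    using integral_unique[OF int] K L by simp
  finally show ?thesis using t by (simp add: prim_def)
qed

lemma norm_prim_pow_exp_le:
  assumes x: "continuous_on {a..b} x" and L: "0 < L"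
    and bound: "\<And>t. t \<in> {a..b} \<Longrightarrow> norm (x t) \<le> K * exp (L * (t - a))" and t: "t \<in> {a..b}"
  shows "norm ((prim ^^ i) x t) \<le> K / L ^ i * exp (L * (t - a))"
  using t
proof (induction i arbitrary: t)
  case 0
  then show ?case using bound by simp
next
  case (Suc i)
  have "norm (prim ((prim ^^ i) x) t) \<le> (K / L ^ i) / L * exp (L * (t - a))"
    by (rule norm_prim_exp_le[OF continuous_on_prim_pow[OF x] L]) (use Suc in auto)
  then show ?case by (simp add: field_simps)
qed

text \<open>For a function with vanishing initial data and \<open>r\<close>-th derivative
  \<open>u\<close>, the derivative of order \<open>s\<close> is \<open>(prim ^^ (r - s)) u\<close>.
  Hence \<open>u + volterra r m A u = g\<close> is the initial value problem written for the highest
  derivative.\<close>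

definition volterra ::
    "nat \<Rightarrow> nat \<Rightarrow> (nat \<Rightarrow> nat \<Rightarrow> nat \<Rightarrow> real \<Rightarrow> complex) \<Rightarrow> (nat \<Rightarrow> real \<Rightarrow> complex) \<Rightarrow> nat \<Rightarrow> real \<Rightarrow> complex"
  where "volterra r m A u i t = (\<Sum>s<r. \<Sum>j<m. A s i j t * (prim ^^ (r - s)) (u j) t)"

text \<open>Since \<open>s < r\<close>, every summand integrates at least once and gains at least
  one factor \<open>1 / L\<close>; \<open>1 \<le> L\<close> takes care of the higher powers.\<close>

lemma norm_volterra_exp_le:
  assumes A: "\<And>s j. s < r \<Longrightarrow> j < m \<Longrightarrow> norm (A s i j t) \<le> M"
    and u: "\<And>j. j < m \<Longrightarrow> continuous_on {a..b} (u j)"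
    and bound: "\<And>j t. j < m \<Longrightarrow> t \<in> {a..b} \<Longrightarrow> norm (u j t) \<le> K * exp (L * (t - a))"
    and L: "1 \<le> L" and K: "0 \<le> K" and M: "0 \<le> M" and t: "t \<in> {a..b}"
  shows "norm (volterra r m A u i t) \<le> real (r * m) * M / L * (K * exp (L * (t - a)))"
proof -
  have "norm (volterra r m A u i t) \<le> (\<Sum>s<r. \<Sum>j<m. norm (A s i j t * (prim ^^ (r - s)) (u j) t))"
    unfolding volterra_def by (intro order_trans[OF norm_sum] sum_mono order_refl)
  also have "\<dots> \<le> (\<Sum>s<r. \<Sum>j<m. M * (K / L * exp (L * (t - a))))"
  proof (intro sum_mono)
    fix s j assume s: "s \<in> {..<r}" and j: "j \<in> {..<m}"
    have "norm ((prim ^^ (r - s)) (u j) t) \<le> K / L ^ (r - s) * exp (L * (t - a))"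
      using norm_prim_pow_exp_le[OF u _ bound t] j L by simp
    also have "\<dots> \<le> K / L * exp (L * (t - a))"
      using s L K power_increasing[of 1 "r - s" L] by (intro mult_right_mono divide_left_mono) auto
    finally show "norm (A s i j t * (prim ^^ (r - s)) (u j) t) \<le> M * (K / L * exp (L * (t - a)))"
      unfolding norm_mult using A s j M by (intro mult_mono) auto
  qed
  finally show ?thesis by (simp add: algebra_simps)
qed

lemma volterra_diff:
  assumes "\<And>j. j < m \<Longrightarrow> continuous_on {a..b} (u j)" and "\<And>j. j < m \<Longrightarrow> continuous_on {a..b} (w j)"
  shows "volterra r m A (\<lambda>j t. u j t - w j t) i t = volterra r m A u i t - volterra r m A w i t"
  unfolding volterra_def sum_subtractf[symmetric] right_diff_distrib[symmetric]
  by (intro sum.cong refl) (simp add: prim_pow_diff assms)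

lemma continuous_on_volterra:
  assumes "\<And>s j. s < r \<Longrightarrow> j < m \<Longrightarrow> continuous_on {a..b} (A s i j)"
    and "\<And>j. j < m \<Longrightarrow> continuous_on {a..b} (u j)"
  shows "continuous_on {a..b} (volterra r m A u i)"
  unfolding volterra_def by (intro continuous_intros continuous_on_prim_pow assms) auto

text \<open>An exponential rate for which the Volterra operator halves the weighted supremum norm with
  weight \<open>exp (- rate * (t - a))\<close>.\<close>

definition bielecki_rate :: "nat \<Rightarrow> nat \<Rightarrow> real \<Rightarrow> real" where
  "bielecki_rate r m M = 1 + 2 * real (r * m) * M"

lemma norm_volterra_bielecki_le:
  assumes A: "\<And>s j. s < r \<Longrightarrow> j < m \<Longrightarrow> norm (A s i j t) \<le> M"
    and u: "\<And>j. j < m \<Longrightarrow> continuous_on {a..b} (u j)"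
    and bound: "\<And>j t. j < m \<Longrightarrow> t \<in> {a..b} \<Longrightarrow> norm (u j t) \<le> K * exp (bielecki_rate r m M * (t - a))"
    and K: "0 \<le> K" and M: "0 \<le> M" and t: "t \<in> {a..b}"
  shows "norm (volterra r m A u i t) \<le> 1/2 * K * exp (bielecki_rate r m M * (t - a))"
proof -
  let ?L = "bielecki_rate r m M"
  have L: "1 \<le> ?L" using M by (simp add: bielecki_rate_def)
  have "norm (volterra r m A u i t) \<le> real (r * m) * M / ?L * (K * exp (?L * (t - a)))"
    by (rule norm_volterra_exp_le) (use A u bound L K M t in auto)
  also have "real (r * m) * M / ?L \<le> 1/2"
    using L by (simp add: field_simps bielecki_rate_def)
  finally show ?thesis using K by (simp add: mult_right_mono)
qed

text \<open>The weighted supremum of a solution satisfies \<open>S \<le> G + S / 2\<close>. The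
  constant depends on the coefficients only through \<open>M\<close>, hence can serve all
  \<open>k\<close> at once, and \<open>G = 0\<close> gives uniqueness.\<close>

lemma volterra_bound:
  assumes A: "\<And>s i j t. s < r \<Longrightarrow> i < m \<Longrightarrow> j < m \<Longrightarrow> t \<in> {a..b} \<Longrightarrow> norm (A s i j t) \<le> M"
    and M: "0 \<le> M"
    and u: "\<And>j. j < m \<Longrightarrow> continuous_on {a..b} (u j)"
    and eq: "\<And>i t. i < m \<Longrightarrow> t \<in> {a..b} \<Longrightarrow> u i t + volterra r m A u i t = g i t"
    and g: "\<And>i t. i < m \<Longrightarrow> t \<in> {a..b} \<Longrightarrow> norm (g i t) \<le> G"
    and it: "i < m" "t \<in> {a..b}"
  shows "norm (u i t) \<le> 2 * exp (bielecki_rate r m M * (b - a)) * G"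
proof -
  let ?L = "bielecki_rate r m M"
  define w where "w t = exp (?L * (t - a))" for t
  have L: "1 \<le> ?L" using M by (simp add: bielecki_rate_def)
  have w1: "1 \<le> w t" if "t \<in> {a..b}" for t
    using that L by (simp add: w_def)
  have G: "0 \<le> G" using g[OF it] norm_ge_zero order_trans by blast
  \<comment> \<open>The weighted norms of all components together. They are bounded because the
    weight is at least 1 on the interval, so absorbing half of \<open>Sup S\<close> is
    legitimate.\<close>
  define S where "S = (\<lambda>(i, t). norm (u i t) / w t) ` ({..<m} \<times> {a..b})"
  have "norm (u i t) / w t \<le> (\<Sum>i<m. cnorm a b 0 (u i))" if "i < m" "t \<in> {a..b}" for i t
  proof -
    have "norm (u i t) / w t \<le> norm (u i t)" using w1[OF that(2)] by (simp add: divide_le_eq mult_le_cancel_left1)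
    also have "\<dots> \<le> cnorm a b 0 (u i)" by (rule norm_le_cnorm_0[OF u]) (use that in auto)
    also have "\<dots> \<le> (\<Sum>i<m. cnorm a b 0 (u i))"
      by (rule member_le_sum) (use that cnorm_0_nonneg u in auto)
    finally show ?thesis .
  qed
  then have bdd: "bdd_above S" unfolding S_def by (intro bdd_aboveI2[of _ _ "\<Sum>i<m. cnorm a b 0 (u i)"]) auto
  have upper: "norm (u i t) \<le> Sup S * w t" if "i < m" "t \<in> {a..b}" for i t
  proof -
    have "norm (u i t) / w t \<le> Sup S" by (rule cSup_upper[OF _ bdd]) (use that S_def in auto)
    then show ?thesis using w1[OF that(2)] by (simp add: divide_le_eq)
  qed
  have K: "0 \<le> Sup S"
    using upper[OF it] w1[OF it(2)] by (meson norm_ge_zero order_trans zero_le_mult_iff not_le zero_less_one less_le_trans)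
  have "norm (u i t) / w t \<le> G + Sup S / 2" if "i < m" "t \<in> {a..b}" for i t
  proof -
    have "norm (volterra r m A u i t) \<le> 1/2 * Sup S * w t"
      unfolding w_def by (rule norm_volterra_bielecki_le) (use A u upper K M that in \<open>auto simp: w_def\<close>)
    moreover have "norm (u i t) \<le> norm (g i t) + norm (volterra r m A u i t)"
      using eq[OF that] norm_triangle_ineq4[of "g i t" "volterra r m A u i t"] by (metis add_diff_cancel_right')
    moreover have "norm (g i t) \<le> G * w t"
      using g[OF that] mult_left_mono[OF w1[OF that(2)] G] by simp
    ultimately have "norm (u i t) \<le> (G + Sup S / 2) * w t" by (simp add: algebra_simps)
    then show ?thesis using w1[OF that(2)] by (simp add: divide_le_eq)
  qed
  then have "Sup S \<le> G + Sup S / 2"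
    using it unfolding S_def by (intro cSup_least) auto
  then have "Sup S \<le> 2 * G" by simp
  then have "norm (u i t) \<le> 2 * G * w t"
    using upper[OF it] w1[OF it(2)] by (meson mult_right_mono order_trans zero_le_one)
  also have "\<dots> \<le> 2 * G * exp (?L * (b - a))"
    unfolding w_def using it G L by (intro mult_left_mono) auto
  finally show ?thesis by (simp add: mult_ac)
qed

text \<open>The fixed point problem is posed for \<open>v = u / w\<close>, so that the weighted norm
  of \<open>u\<close> becomes the plain supremum norm of \<open>v\<close>.\<close>

lemma volterra_solvable:
  assumes Ac: "\<And>s i j. s < r \<Longrightarrow> i < m \<Longrightarrow> j < m \<Longrightarrow> continuous_on {a..b} (A s i j)"
    and A: "\<And>s i j t. s < r \<Longrightarrow> i < m \<Longrightarrow> j < m \<Longrightarrow> t \<in> {a..b} \<Longrightarrow> norm (A s i j t) \<le> M"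
    and M: "0 \<le> M"
    and g: "\<And>i. i < m \<Longrightarrow> continuous_on {a..b} (g i)"
  obtains u where "\<And>i. i < m \<Longrightarrow> continuous_on {a..b} (u i)"
    and "\<And>i t. i < m \<Longrightarrow> t \<in> {a..b} \<Longrightarrow> u i t + volterra r m A u i t = g i t"
proof -
  define L where "L = bielecki_rate r m M"
  define w where "w t = exp (L * (t - a))" for t
  have w: "w t > 0" for t by (simp add: w_def)
  have wc: "continuous_on S w" for S unfolding w_def by (intro continuous_intros)
  \<comment> \<open>The complete space consists of functions on the whole line; composing with this
    retraction extends a function from the interval by its endpoint values.\<close>
  define cl where "cl t = max a (min b t)" for t
  have cl: "cl t \<in> {a..b}" "t \<in> {a..b} \<Longrightarrow> cl t = t" for t using ab by (auto simp: cl_def)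
  have clc: "continuous_on UNIV cl" unfolding cl_def by (intro continuous_intros)
  define E where "E f = (\<lambda>(d, t). if of_discrete d < m then f (of_discrete d) (cl t) / of_real (w (cl t)) else 0)"
    for f :: "nat \<Rightarrow> real \<Rightarrow> complex"
  have E: "E f \<in> bcontfun" if f: "\<And>i. i < m \<Longrightarrow> continuous_on {a..b} (f i)" for f
  proof (rule bcontfun_discrete_prodI)
    have q: "continuous_on {a..b} (\<lambda>t. f i t / of_real (w t))" if "i < m" for i
      using w that by (intro continuous_intros f wc) (auto simp: less_imp_neq[symmetric])
    show "continuous_on UNIV (\<lambda>t. E f (d, t))" for d
      using continuous_on_compose2[OF q clc, of "of_discrete d"] image_subsetI[of UNIV cl, OF cl(1)]
      by (cases "of_discrete d < m") (simp_all add: E_def)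
    show "norm (E f p) \<le> (\<Sum>i<m. cnorm a b 0 (\<lambda>t. f i t / of_real (w t)))" for p
    proof (cases "of_discrete (fst p) < m")
      case True
      then have "norm (E f p) \<le> cnorm a b 0 (\<lambda>t. f (of_discrete (fst p)) t / of_real (w t))"
        using norm_le_cnorm_0[OF q[OF True] cl(1), of "snd p"] by (simp add: E_def case_prod_unfold)
      also have "\<dots> \<le> (\<Sum>i<m. cnorm a b 0 (\<lambda>t. f i t / of_real (w t)))"
        by (rule member_le_sum) (use True cnorm_0_nonneg q in auto)
      finally show ?thesis .
    next
      case False
      then show ?thesis using cnorm_0_nonneg q by (auto simp: E_def case_prod_unfold intro!: sum_nonneg)
    qed
  qed
  \<comment> \<open>Multiplication by the weight, which undoes the division in \<open>E\<close> on
    the interval.\<close>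
  define U where "U v j t = of_real (w t) * apply_bcontfun v (discrete j, t)"
    for v :: "(nat discrete \<times> real) \<Rightarrow>\<^sub>C complex" and j t
  have Uc: "continuous_on {a..b} (U v j)" for v j
    unfolding U_def
    by (intro continuous_intros wc continuous_on_compose2[OF continuous_on_apply_bcontfun[of UNIV]]) auto
  have Ub: "norm (U v j t) \<le> norm v * w t" for v j t
    using norm_bounded[of v "(discrete j, t)"] w[of t] by (simp add: U_def norm_mult mult.commute)
  \<comment> \<open>The Volterra operator conjugated by the weight; its norm is at most 1/2 by the
    choice of the rate.\<close>
  define T where "T v = Bcontfun (E (volterra r m A (U v)))" for v
  have T: "apply_bcontfun (T v) = E (volterra r m A (U v))" for v
    unfolding T_def by (intro Bcontfun_inverse E continuous_on_volterra Ac Uc)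
  have "apply_bcontfun (T (v - v')) p = apply_bcontfun (T v - T v') p" for v v' p
  proof -
    have "U (v - v') = (\<lambda>j t. U v j t - U v' j t)" by (simp add: U_def fun_eq_iff algebra_simps)
    then show ?thesis using volterra_diff[of m "U v" "U v'" r A] Uc
      by (simp add: T E_def case_prod_unfold diff_divide_distrib)
  qed
  then have Tdiff: "T (v - v') = T v - T v'" for v v' by (rule bcontfun_eqI)
  have "norm (apply_bcontfun (T v) (d, t)) \<le> 1/2 * norm v" for v d t
  proof (cases "of_discrete d < m")
    case True
    have "norm (volterra r m A (U v) (of_discrete d) (cl t)) \<le> 1/2 * norm v * w (cl t)"
      unfolding w_def L_def
      by (rule norm_volterra_bielecki_le[OF A])
        (use True cl M Uc Ub[unfolded w_def L_def] in auto)
    then show ?thesis using True w[of "cl t"] by (simp add: T E_def norm_divide divide_le_eq)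
  qed (simp add: T E_def)
  then have Tb: "norm (T v) \<le> 1/2 * norm v" for v by (intro norm_bound) auto
  have "\<exists>v. v + T v = Bcontfun (E g)"
    by (rule id_plus_contraction_surj[where c = "1/2"]) (use Tdiff Tb in auto)
  then obtain v where v: "v + T v = Bcontfun (E g)" ..
  have "U v i t + volterra r m A (U v) i t = g i t" if "i < m" "t \<in> {a..b}" for i t
  proof -
    have "apply_bcontfun v (discrete i, t) + apply_bcontfun (T v) (discrete i, t) = E g (discrete i, t)"
      using arg_cong[OF v, of "\<lambda>f. apply_bcontfun f (discrete i, t)"] Bcontfun_inverse[OF E[OF g]] by simp
    then have "apply_bcontfun v (discrete i, t) + volterra r m A (U v) i t / of_real (w t) = g i t / of_real (w t)"
      using that cl by (simp add: T E_def discrete_inverse)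
    then show ?thesis using w[of t] by (simp add: U_def field_simps)
  qed
  then show ?thesis using that[of "U v"] Uc by blast
qed

subsection \<open>Initial value problems\<close>

lemma CvecD: "y \<in> Cvec a b l m \<Longrightarrow> i < m \<Longrightarrow> Cl a b l (y i)"
  by (simp add: Cvec_def)

lemma Cvec_outside: "y \<in> Cvec a b l m \<Longrightarrow> m \<le> i \<or> t \<notin> {a..b} \<Longrightarrow> y i t = 0"
  by (simp add: Cvec_def)

lemma Cvec_eqI:
  assumes "x \<in> Cvec a b l m" and "y \<in> Cvec a b k m"
    and "\<And>i t. i < m \<Longrightarrow> t \<in> {a..b} \<Longrightarrow> x i t = y i t"
  shows "x = y"
  by (intro ext) (metis assms Cvec_outside not_le)

lemma Cvec_zero: "(\<lambda>i t. 0) \<in> Cvec a b l m"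
  by (simp add: Cvec_def Cl_zero)

lemma Cvec_add: "x \<in> Cvec a b l m \<Longrightarrow> y \<in> Cvec a b l m \<Longrightarrow> (\<lambda>i t. x i t + y i t) \<in> Cvec a b l m"
  by (auto simp: Cvec_def Cl_add)

lemma Cvec_diff: "x \<in> Cvec a b l m \<Longrightarrow> y \<in> Cvec a b l m \<Longrightarrow> (\<lambda>i t. x i t - y i t) \<in> Cvec a b l m"
  by (auto simp: Cvec_def Cl_diff)

lemma Cvec_cmult: "x \<in> Cvec a b l m \<Longrightarrow> (\<lambda>i t. c * x i t) \<in> Cvec a b l m"
  by (auto simp: Cvec_def Cl_cmult)

lemma Cvec_sum:
  "(\<And>k. k \<in> S \<Longrightarrow> x k \<in> Cvec a b l m) \<Longrightarrow> (\<lambda>i t. \<Sum>k\<in>S. x k i t) \<in> Cvec a b l m"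
  by (auto simp: Cvec_def intro!: Cl_sum sum.neutral)

lemma cvnorm_nonneg: "x \<in> Cvec a b l m \<Longrightarrow> 0 \<le> cvnorm a b l m x"
  unfolding cvnorm_def by (intro sum_nonneg) (auto intro: cnorm_nonneg CvecD)

lemma cnorm_le_cvnorm: "x \<in> Cvec a b l m \<Longrightarrow> i < m \<Longrightarrow> cnorm a b l (x i) \<le> cvnorm a b l m x"
  unfolding cvnorm_def by (rule member_le_sum) (auto intro: cnorm_nonneg CvecD)

lemma cvnorm_add_le:
  "x \<in> Cvec a b l m \<Longrightarrow> y \<in> Cvec a b l m \<Longrightarrow>
    cvnorm a b l m (\<lambda>i t. x i t + y i t) \<le> cvnorm a b l m x + cvnorm a b l m y"
  unfolding cvnorm_def sum.distrib[symmetric] by (intro sum_mono cnorm_add_le) (auto intro: CvecD)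

lemma cvnorm_cmult_le:
  "x \<in> Cvec a b l m \<Longrightarrow> cvnorm a b l m (\<lambda>i t. c * x i t) \<le> norm c * cvnorm a b l m x"
  unfolding cvnorm_def sum_distrib_left by (intro sum_mono cnorm_cmult_le) (auto intro: CvecD)

lemma cvnorm_sum_le:
  assumes "\<And>k. k \<in> S \<Longrightarrow> x k \<in> Cvec a b l m"
  shows "cvnorm a b l m (\<lambda>i t. \<Sum>k\<in>S. x k i t) \<le> (\<Sum>k\<in>S. cvnorm a b l m (x k))"
proof -
  have "cvnorm a b l m (\<lambda>i t. \<Sum>k\<in>S. x k i t) \<le> (\<Sum>i<m. \<Sum>k\<in>S. cnorm a b l (x k i))"
    unfolding cvnorm_def by (intro sum_mono cnorm_sum_le) (use assms in \<open>auto intro: CvecD\<close>)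
  then show ?thesis unfolding cvnorm_def by (subst sum.swap)
qed

lemma cvnorm_le_diff:
  assumes "x \<in> Cvec a b l m" and "y \<in> Cvec a b l m"
  shows "cvnorm a b l m x \<le> cvnorm a b l m y + cvnorm a b l m (\<lambda>i t. x i t - y i t)"
  using cvnorm_add_le[OF assms(2) Cvec_diff[OF assms]] by simp

lemma CmatD: "A \<in> Cmat a b l m \<Longrightarrow> i < m \<Longrightarrow> j < m \<Longrightarrow> Cl a b l (A i j)"
  by (simp add: Cmat_def)

lemma Cmat_diff:
  "A \<in> Cmat a b l m \<Longrightarrow> A' \<in> Cmat a b l m \<Longrightarrow> (\<lambda>i j t. A i j t - A' i j t) \<in> Cmat a b l m"
  by (auto simp: Cmat_def Cl_diff)

lemma cmnorm_nonneg: "A \<in> Cmat a b l m \<Longrightarrow> 0 \<le> cmnorm a b l m A"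
  unfolding cmnorm_def by (intro sum_nonneg) (auto intro: cnorm_nonneg CmatD)

lemma cnorm_le_cmnorm:
  assumes "A \<in> Cmat a b l m" and "i < m" and "j < m"
  shows "cnorm a b l (A i j) \<le> cmnorm a b l m A"
proof -
  have "cnorm a b l (A i j) \<le> (\<Sum>j<m. cnorm a b l (A i j))"
    by (rule member_le_sum) (use assms in \<open>auto intro: cnorm_nonneg CmatD\<close>)
  also have "\<dots> \<le> cmnorm a b l m A"
    unfolding cmnorm_def
    by (rule member_le_sum) (use assms in \<open>auto intro!: sum_nonneg cnorm_nonneg CmatD\<close>)
  finally show ?thesis .
qed

lemma cmnorm_diff_le:
  assumes "A \<in> Cmat a b l m" and "A' \<in> Cmat a b l m"
  shows "cmnorm a b l m (\<lambda>i j t. A i j t - A' i j t) \<le> cmnorm a b l m A + cmnorm a b l m A'"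
  unfolding cmnorm_def sum.distrib[symmetric]
  by (intro sum_mono cnorm_diff_le) (use assms in \<open>auto intro: CmatD\<close>)

lemma cmnorm_le_diff:
  assumes "A \<in> Cmat a b l m" and "A' \<in> Cmat a b l m"
  shows "cmnorm a b l m A' \<le> cmnorm a b l m A + cmnorm a b l m (\<lambda>i j t. A i j t - A' i j t)"
  using cmnorm_diff_le[OF assms(1) Cmat_diff[OF assms]] by simp

section \<open>The lower-order part of the differential operator\<close>

definition lower_terms ::
    "nat \<Rightarrow> nat \<Rightarrow> (nat \<Rightarrow> nat \<Rightarrow> nat \<Rightarrow> real \<Rightarrow> complex) \<Rightarrow> (nat \<Rightarrow> real \<Rightarrow> complex) \<Rightarrow> nat \<Rightarrow> real \<Rightarrow> complex"
  where "lower_terms r m A y i t =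
    (if i < m \<and> t \<in> {a..b} then \<Sum>s<r. \<Sum>j<m. A s i j t * hderiv a b s (y j) t else 0)"

lemma solves_ode_iff:
  "solves_ode a b r m A f y \<longleftrightarrow>
    (\<forall>i<m. \<forall>t\<in>{a..b}. hderiv a b r (y i) t + lower_terms r m A y i t = f i t)"
  by (auto simp: solves_ode_def lower_terms_def)

lemma lower_terms_diff_coeff:
  "lower_terms r m (\<lambda>s i j t. A s i j t - A' s i j t) y i t =
    lower_terms r m A y i t - lower_terms r m A' y i t"
  by (simp add: lower_terms_def left_diff_distrib sum_subtractf)

lemma lower_terms_add:
  assumes "x \<in> Cvec a b n m" and "y \<in> Cvec a b n m" and "r \<le> n"
  shows "lower_terms r m A (\<lambda>i t. x i t + y i t) i t = lower_terms r m A x i t + lower_terms r m A y i t"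
proof -
  have "hderiv a b s (\<lambda>t. x j t + y j t) t = hderiv a b s (x j) t + hderiv a b s (y j) t"
    if "s < r" "j < m" "t \<in> {a..b}" for s j
    by (rule hderiv_add[of n]) (use assms that in \<open>auto intro: CvecD\<close>)
  then show ?thesis by (simp add: lower_terms_def sum.distrib[symmetric] distrib_left)
qed

lemma lower_terms_cmult:
  assumes "x \<in> Cvec a b n m" and "r \<le> n"
  shows "lower_terms r m A (\<lambda>i t. c * x i t) i t = c * lower_terms r m A x i t"
proof -
  have "hderiv a b s (\<lambda>t. c * x j t) t = c * hderiv a b s (x j) t"
    if "s < r" "j < m" "t \<in> {a..b}" for s j
    by (rule hderiv_cmult[of n]) (use assms that in \<open>auto intro: CvecD\<close>)
  then show ?thesis by (simp add: lower_terms_def sum_distrib_left mult_ac)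
qed

lemma solves_ode_add:
  assumes "x \<in> Cvec a b n m" and "y \<in> Cvec a b n m" and "r \<le> n"
    and "solves_ode a b r m A f x" and "solves_ode a b r m A g y"
  shows "solves_ode a b r m A (\<lambda>i t. f i t + g i t) (\<lambda>i t. x i t + y i t)"
  unfolding solves_ode_iff
proof (intro allI impI ballI)
  fix i t assume it: "i < m" "t \<in> {a..b}"
  then have "hderiv a b r (\<lambda>t. x i t + y i t) t = hderiv a b r (x i) t + hderiv a b r (y i) t"
    using assms by (intro hderiv_add[of n]) (auto intro: CvecD)
  then show "hderiv a b r (\<lambda>t. x i t + y i t) t + lower_terms r m A (\<lambda>i t. x i t + y i t) i t = f i t + g i t"
    using assms(4)[unfolded solves_ode_iff, rule_format, OF it, symmetric]
      assms(5)[unfolded solves_ode_iff, rule_format, OF it, symmetric]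
    by (simp add: lower_terms_add[OF assms(1-3)] algebra_simps)
qed

lemma solves_ode_cmult:
  assumes "x \<in> Cvec a b n m" and "r \<le> n" and "solves_ode a b r m A f x"
  shows "solves_ode a b r m A (\<lambda>i t. c * f i t) (\<lambda>i t. c * x i t)"
  unfolding solves_ode_iff
proof (intro allI impI ballI)
  fix i t assume it: "i < m" "t \<in> {a..b}"
  then have "hderiv a b r (\<lambda>t. c * x i t) t = c * hderiv a b r (x i) t"
    using assms by (intro hderiv_cmult[of n]) (auto intro: CvecD)
  then show "hderiv a b r (\<lambda>t. c * x i t) t + lower_terms r m A (\<lambda>i t. c * x i t) i t = c * f i t"
    using assms(3)[unfolded solves_ode_iff, rule_format, OF it, symmetric]
    by (simp add: lower_terms_cmult[OF assms(1,2)] algebra_simps)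
qed

lemma solves_ode_diff:
  assumes "x \<in> Cvec a b n m" and "y \<in> Cvec a b n m" and "r \<le> n"
    and "solves_ode a b r m A f x" and "solves_ode a b r m A g y"
  shows "solves_ode a b r m A (\<lambda>i t. f i t - g i t) (\<lambda>i t. x i t - y i t)"
  using solves_ode_add[OF assms(1) Cvec_cmult[OF assms(2)] assms(3,4) solves_ode_cmult[OF assms(2,3,5)], of "-1"]
  by simp

text \<open>Derivatives of order \<open>s < r\<close> of a \<open>C\<^sup>n\<close> function are at
  least of class \<open>C\<^sup>(n-r)\<close>, so the product estimate applies termwise. The bound
  is linear in the coefficients: for a difference of coefficients it measures the perturbation of
  the operator.\<close>

lemma lower_terms_Cvec:
  assumes A: "\<And>s. s < r \<Longrightarrow> A s \<in> Cmat a b (n - r) m" and y: "y \<in> Cvec a b n m" and r: "r \<le> n"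
  shows "lower_terms r m A y \<in> Cvec a b (n - r) m"
    and "cvnorm a b (n - r) m (lower_terms r m A y) \<le>
      2 ^ (n - r) * (\<Sum>s<r. cmnorm a b (n - r) m (A s)) * cvnorm a b n m y"
proof -
  let ?l = "n - r"
  have y': "Cl a b ?l (hderiv a b s (y j))" if "s < r" "j < m" for s j
    by (rule Cl_hderiv[of n]) (use y that r in \<open>auto intro: CvecD\<close>)
  have C: "Cl a b ?l (\<lambda>t. A s i j t * hderiv a b s (y j) t)" if "s < r" "i < m" "j < m" for s i j
    using that by (intro Cl_mult y') (use A in \<open>auto intro: CmatD\<close>)
  have eq: "lower_terms r m A y i t = (\<Sum>s<r. \<Sum>j<m. A s i j t * hderiv a b s (y j) t)"
    if "i < m" "t \<in> {a..b}" for i t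
    using that by (simp add: lower_terms_def)
  have "Cl a b ?l (lower_terms r m A y i)" if "i < m" for i
    by (subst Cl_cong[OF eq[OF that]]) (use that in \<open>auto intro!: Cl_sum C\<close>)
  then show "lower_terms r m A y \<in> Cvec a b ?l m"
    by (auto simp: Cvec_def lower_terms_def)
  have "cnorm a b ?l (\<lambda>t. A s i j t * hderiv a b s (y j) t) \<le>
      2 ^ ?l * cnorm a b ?l (A s i j) * cvnorm a b n m y" if "s < r" "i < m" "j < m" for s i j
  proof -
    have "cnorm a b ?l (\<lambda>t. A s i j t * hderiv a b s (y j) t) \<le>
        2 ^ ?l * cnorm a b ?l (A s i j) * cnorm a b ?l (hderiv a b s (y j))"
      using that A y' by (intro cnorm_mult_le) (auto intro: CmatD)
    also have "cnorm a b ?l (hderiv a b s (y j)) \<le> cnorm a b n (y j)"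
      using that y r by (intro cnorm_hderiv_le) (auto intro: CvecD)
    also have "cnorm a b n (y j) \<le> cvnorm a b n m y"
      using that y cnorm_le_cvnorm by blast
    finally show ?thesis
      using cnorm_nonneg[OF CmatD[OF A]] that by (simp add: mult_left_mono)
  qed
  then have *: "(\<Sum>s<r. \<Sum>j<m. cnorm a b ?l (\<lambda>t. A s i j t * hderiv a b s (y j) t)) \<le>
      (\<Sum>s<r. \<Sum>j<m. 2 ^ ?l * cnorm a b ?l (A s i j) * cvnorm a b n m y)" if "i < m" for i
    using that by (intro sum_mono) auto
  have "cnorm a b ?l (lower_terms r m A y i) \<le>
      (\<Sum>s<r. \<Sum>j<m. 2 ^ ?l * cnorm a b ?l (A s i j) * cvnorm a b n m y)" if "i < m" for i
  proof -
    have "cnorm a b ?l (lower_terms r m A y i) =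
        cnorm a b ?l (\<lambda>t. \<Sum>s<r. \<Sum>j<m. A s i j t * hderiv a b s (y j) t)"
      by (rule cnorm_cong) (rule eq[OF that])
    also have "\<dots> \<le> (\<Sum>s<r. cnorm a b ?l (\<lambda>t. \<Sum>j<m. A s i j t * hderiv a b s (y j) t))"
      using C that by (intro cnorm_sum_le Cl_sum) auto
    also have "\<dots> \<le> (\<Sum>s<r. \<Sum>j<m. cnorm a b ?l (\<lambda>t. A s i j t * hderiv a b s (y j) t))"
      using C that by (intro sum_mono cnorm_sum_le) auto
    finally show ?thesis using *[OF that] by linarith
  qed
  then have "cvnorm a b ?l m (lower_terms r m A y) \<le>
      (\<Sum>i<m. \<Sum>s<r. \<Sum>j<m. 2 ^ ?l * cnorm a b ?l (A s i j) * cvnorm a b n m y)"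
    unfolding cvnorm_def by (intro sum_mono) auto
  also have "\<dots> = (\<Sum>s<r. \<Sum>i<m. \<Sum>j<m. 2 ^ ?l * cnorm a b ?l (A s i j) * cvnorm a b n m y)"
    by (rule sum.swap)
  also have "\<dots> = 2 ^ ?l * (\<Sum>s<r. cmnorm a b ?l m (A s)) * cvnorm a b n m y"
    by (simp add: cmnorm_def sum_distrib_left sum_distrib_right)
  finally show "cvnorm a b ?l m (lower_terms r m A y) \<le> \<dots>" .
qed

section \<open>Regularity, solvability, uniqueness and perturbation of initial value
  problems\<close>

lemma norm_coeff_le:
  assumes "A \<in> Cmat a b l m" and "cmnorm a b l m A \<le> M" and "i < m" and "j < m" and "t \<in> {a..b}"
  shows "norm (A i j t) \<le> M"
  using norm_hderiv_le_cnorm[of l "A i j" 0 t] cnorm_le_cmnorm[of A l m i j] assms CmatD by fastforce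

text \<open>Bootstrapping in \<open>u = g - volterra r m A u\<close>: the Volterra term integrates
  \<open>u\<close> at least once, so it is one order smoother than \<open>u\<close> as long as the
  coefficients allow it. \<open>C\<close> is chosen before \<open>A\<close>, \<open>g\<close> and
  \<open>u\<close>, so it is the same for all coefficients bounded by \<open>M\<close>.\<close>

lemma volterra_regularity:
  assumes "k \<le> l" and M: "0 \<le> M"
  shows "\<exists>C\<ge>0. \<forall>A g u. (\<forall>s<r. A s \<in> Cmat a b l m \<and> cmnorm a b l m (A s) \<le> M) \<longrightarrow>
      g \<in> Cvec a b l m \<longrightarrow> (\<forall>i<m. continuous_on {a..b} (u i)) \<longrightarrow>
      (\<forall>i<m. \<forall>t\<in>{a..b}. u i t + volterra r m A u i t = g i t) \<longrightarrow>
      (\<forall>i<m. Cl a b k (u i) \<and> cnorm a b k (u i) \<le> C * cvnorm a b l m g)"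
  using assms(1)
proof (induction k)
  case 0
  let ?C = "2 * exp (bielecki_rate r m M * (b - a))"
  have "Cl a b 0 (u i) \<and> cnorm a b 0 (u i) \<le> ?C * cvnorm a b l m g"
    if A: "\<forall>s<r. A s \<in> Cmat a b l m \<and> cmnorm a b l m (A s) \<le> M" and g: "g \<in> Cvec a b l m"
      and u: "\<forall>i<m. continuous_on {a..b} (u i)"
      and eq: "\<forall>i<m. \<forall>t\<in>{a..b}. u i t + volterra r m A u i t = g i t" and i: "i < m"
    for A g u i
  proof
    show "Cl a b 0 (u i)" using u i by (simp add: Cl_0)
    have "norm (g i t) \<le> cvnorm a b l m g" if "i < m" "t \<in> {a..b}" for i t
      using norm_hderiv_le_cnorm[of l "g i" 0 t] cnorm_le_cvnorm[OF g that(1)] g CvecD that by fastforce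
    then show "cnorm a b 0 (u i) \<le> ?C * cvnorm a b l m g"
      using A u eq i M norm_coeff_le by (intro cnorm_0_le volterra_bound[where A = A and u = u and g = g]) blast+
  qed
  then show ?case by (intro exI[of _ ?C]) auto
next
  case (Suc k)
  then obtain C where C: "0 \<le> C" and IH: "\<And>A g u i. (\<forall>s<r. A s \<in> Cmat a b l m \<and> cmnorm a b l m (A s) \<le> M) \<Longrightarrow>
      g \<in> Cvec a b l m \<Longrightarrow> (\<forall>i<m. continuous_on {a..b} (u i)) \<Longrightarrow>
      (\<forall>i<m. \<forall>t\<in>{a..b}. u i t + volterra r m A u i t = g i t) \<Longrightarrow> i < m \<Longrightarrow>
      Cl a b k (u i) \<and> cnorm a b k (u i) \<le> C * cvnorm a b l m g"
    by (metis Suc_leD)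
  define D where "D = 1 + (b - a)"
  have D: "1 \<le> D" using ab by (simp add: D_def)
  \<comment> \<open>The 1 stands for \<open>g\<close>; each of the \<open>r * m\<close> products
    contributes the product constant, the coefficient bound \<open>M\<close> and the bound
    \<open>D ^ r * C\<close> for the iterated primitives of \<open>u\<close>.\<close>
  define C' where "C' = 1 + real r * (real m * (2 ^ Suc k * M * (D ^ r * C)))"
  have "0 \<le> C'" using C M D by (simp add: C'_def)
  moreover have "Cl a b (Suc k) (u i) \<and> cnorm a b (Suc k) (u i) \<le> C' * cvnorm a b l m g"
    if A: "\<forall>s<r. A s \<in> Cmat a b l m \<and> cmnorm a b l m (A s) \<le> M" and g: "g \<in> Cvec a b l m"
      and u: "\<forall>i<m. continuous_on {a..b} (u i)"
      and eq: "\<forall>i<m. \<forall>t\<in>{a..b}. u i t + volterra r m A u i t = g i t" and i: "i < m"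
    for A g u i
  proof -
    let ?G = "cvnorm a b l m g"
    note IH = IH[OF A g u eq]
    have G: "0 \<le> ?G" using g by (rule cvnorm_nonneg)
    have P: "Cl a b (Suc k) ((prim ^^ (r - s)) (u j)) \<and> cnorm a b (Suc k) ((prim ^^ (r - s)) (u j)) \<le> D ^ r * C * ?G"
      if "s < r" "j < m" for s j
    proof
      have c: "Cl a b (k + (r - s)) ((prim ^^ (r - s)) (u j))"
        using IH that by (intro Cl_prim_pow) auto
      then show "Cl a b (Suc k) ((prim ^^ (r - s)) (u j))"
        by (rule Cl_mono) (use that in auto)
      have "cnorm a b (Suc k) ((prim ^^ (r - s)) (u j)) \<le> cnorm a b (k + (r - s)) ((prim ^^ (r - s)) (u j))"
        by (rule cnorm_mono[OF c]) (use that in auto)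
      also have "\<dots> \<le> D ^ (r - s) * cnorm a b k (u j)"
        unfolding D_def using IH that by (intro cnorm_prim_pow_le) auto
      also have "\<dots> \<le> D ^ r * (C * ?G)"
        using D IH that C G by (intro mult_mono power_increasing) (auto intro: cnorm_nonneg)
      finally show "cnorm a b (Suc k) ((prim ^^ (r - s)) (u j)) \<le> D ^ r * C * ?G" by (simp add: mult.assoc)
    qed
    have AC: "Cl a b (Suc k) (A s i j)" "cnorm a b (Suc k) (A s i j) \<le> M" if "s < r" "j < m" for s j
    proof -
      have c: "Cl a b l (A s i j)" using A that i CmatD by blast
      then show "Cl a b (Suc k) (A s i j)" using Cl_mono Suc.prems by blast
      have "cnorm a b (Suc k) (A s i j) \<le> cnorm a b l (A s i j)" by (rule cnorm_mono[OF c Suc.prems])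
      also have "\<dots> \<le> cmnorm a b l m (A s)" using A that i cnorm_le_cmnorm by blast
      also have "\<dots> \<le> M" using A that by blast
      finally show "cnorm a b (Suc k) (A s i j) \<le> M" .
    qed
    have T: "Cl a b (Suc k) (\<lambda>t. A s i j t * (prim ^^ (r - s)) (u j) t)" if "s < r" "j < m" for s j
      using AC P that by (intro Cl_mult) auto
    have "cnorm a b (Suc k) (\<lambda>t. A s i j t * (prim ^^ (r - s)) (u j) t) \<le> 2 ^ Suc k * M * (D ^ r * C * ?G)"
      if "s < r" "j < m" for s j
    proof -
      have "cnorm a b (Suc k) (\<lambda>t. A s i j t * (prim ^^ (r - s)) (u j) t) \<le>
          2 ^ Suc k * cnorm a b (Suc k) (A s i j) * cnorm a b (Suc k) ((prim ^^ (r - s)) (u j))"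
        using AC P that by (intro cnorm_mult_le) auto
      also have "\<dots> \<le> 2 ^ Suc k * M * (D ^ r * C * ?G)"
        using AC P that M by (intro mult_mono mult_left_mono cnorm_nonneg) auto
      finally show ?thesis .
    qed
    then have b: "(\<Sum>s<r. \<Sum>j<m. cnorm a b (Suc k) (\<lambda>t. A s i j t * (prim ^^ (r - s)) (u j) t)) \<le>
        (\<Sum>s<r. \<Sum>j<m. 2 ^ Suc k * M * (D ^ r * C * ?G))"
      by (intro sum_mono) auto
    have V: "Cl a b (Suc k) (volterra r m A u i)"
      unfolding volterra_def using T by (intro Cl_sum) auto
    have "cnorm a b (Suc k) (volterra r m A u i) \<le>
        (\<Sum>s<r. cnorm a b (Suc k) (\<lambda>t. \<Sum>j<m. A s i j t * (prim ^^ (r - s)) (u j) t))"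
      unfolding volterra_def using T by (intro cnorm_sum_le Cl_sum) auto
    also have "\<dots> \<le> (\<Sum>s<r. \<Sum>j<m. cnorm a b (Suc k) (\<lambda>t. A s i j t * (prim ^^ (r - s)) (u j) t))"
      using T by (intro sum_mono cnorm_sum_le) auto
    also note b
    finally have Vb: "cnorm a b (Suc k) (volterra r m A u i) \<le> real r * (real m * (2 ^ Suc k * M * (D ^ r * C * ?G)))"
      by simp
    have gC: "Cl a b (Suc k) (g i)" using Cl_mono[OF CvecD[OF g i] Suc.prems] .
    have "cnorm a b (Suc k) (g i) \<le> ?G"
      using cnorm_mono[OF CvecD[OF g i] Suc.prems] cnorm_le_cvnorm[OF g i] by linarith
    moreover have ueq: "u i t = g i t - volterra r m A u i t" if "t \<in> {a..b}" for t
      using eq i that by (metis add_diff_cancel_right')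
    ultimately have "cnorm a b (Suc k) (u i) \<le> ?G + real r * (real m * (2 ^ Suc k * M * (D ^ r * C * ?G)))"
      using cnorm_diff_le[OF gC V] Vb cnorm_cong[of "u i" "\<lambda>t. g i t - volterra r m A u i t" "Suc k", OF ueq] by linarith
    moreover have "Cl a b (Suc k) (u i)"
      using Cl_cong[of "u i" "\<lambda>t. g i t - volterra r m A u i t" "Suc k", OF ueq] Cl_diff[OF gC V] by simp
    ultimately show ?thesis by (simp add: C'_def algebra_simps)
  qed
  ultimately show ?case by blast
qed

text \<open>The solution is the \<open>r\<close>-fold primitive of the solution \<open>u\<close> of
  the Volterra equation. Regularity up to order \<open>n - r\<close> for \<open>u\<close> gives
  \<open>C\<^sup>n\<close> for \<open>w\<close>, with a constant uniform in the
  coefficients.\<close>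

lemma ivp_solvable:
  assumes r: "1 \<le> r" "r \<le> n" and M: "0 \<le> M"
  shows "\<exists>C\<ge>0. \<forall>A. (\<forall>s<r. A s \<in> Cmat a b (n - r) m \<and> cmnorm a b (n - r) m (A s) \<le> M) \<longrightarrow>
    (\<forall>g\<in>Cvec a b (n - r) m. \<exists>w\<in>Cvec a b n m. solves_ode a b r m A g w \<and>
      (\<forall>s<r. \<forall>i<m. hderiv a b s (w i) a = 0) \<and> cvnorm a b n m w \<le> C * cvnorm a b (n - r) m g)"
proof -
  let ?l = "n - r"
  obtain C where C: "0 \<le> C" and reg: "\<And>A g u i. (\<forall>s<r. A s \<in> Cmat a b ?l m \<and> cmnorm a b ?l m (A s) \<le> M) \<Longrightarrow>
      g \<in> Cvec a b ?l m \<Longrightarrow> (\<forall>i<m. continuous_on {a..b} (u i)) \<Longrightarrow>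
      (\<forall>i<m. \<forall>t\<in>{a..b}. u i t + volterra r m A u i t = g i t) \<Longrightarrow> i < m \<Longrightarrow>
      Cl a b ?l (u i) \<and> cnorm a b ?l (u i) \<le> C * cvnorm a b ?l m g"
    using volterra_regularity[of ?l ?l M r m, OF order_refl M] by metis
  define D where "D = 1 + (b - a)"
  have D: "1 \<le> D" using ab by (simp add: D_def)
  have "\<exists>w\<in>Cvec a b n m. solves_ode a b r m A g w \<and>
      (\<forall>s<r. \<forall>i<m. hderiv a b s (w i) a = 0) \<and> cvnorm a b n m w \<le> real m * (D ^ r * C) * cvnorm a b ?l m g"
    if A: "\<forall>s<r. A s \<in> Cmat a b ?l m \<and> cmnorm a b ?l m (A s) \<le> M" and g: "g \<in> Cvec a b ?l m" for A g
  proof -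
    have Ac: "continuous_on {a..b} (A s i j)" if "s < r" "i < m" "j < m" for s i j
      using A that CmatD continuous_on_Cl by blast
    have Ab: "norm (A s i j t) \<le> M" if "s < r" "i < m" "j < m" "t \<in> {a..b}" for s i j t
      using A that norm_coeff_le by blast
    have gc: "continuous_on {a..b} (g i)" if "i < m" for i
      using g that CvecD continuous_on_Cl by blast
    obtain u where "\<And>i. i < m \<Longrightarrow> continuous_on {a..b} (u i)"
      and "\<And>i t. i < m \<Longrightarrow> t \<in> {a..b} \<Longrightarrow> u i t + volterra r m A u i t = g i t"
      by (rule volterra_solvable[of r m A M g]) (use Ac Ab M gc in blast)+
    then have u: "\<forall>i<m. continuous_on {a..b} (u i)"
      and eq: "\<forall>i<m. \<forall>t\<in>{a..b}. u i t + volterra r m A u i t = g i t"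
      by blast+
    note reg = reg[OF A g u eq]
    define w where "w i = (if i < m then (prim ^^ r) (u i) else (\<lambda>t. 0))" for i
    have n: "n = ?l + r" using r by simp
    have Cw: "Cl a b n (w i)" if "i < m" for i
      using Cl_prim_pow[of ?l "u i" r] reg that n by (simp add: w_def)
    then have w: "w \<in> Cvec a b n m"
      using prim_pow_outside[of r] r by (simp add: Cvec_def w_def)
    have d: "hderiv a b s (w i) t = (prim ^^ (r - s)) (u i) t" if "s \<le> r" "i < m" "t \<in> {a..b}" for s i t
      using hderiv_prim_pow[of "u i" t s "r - s"] u that by (simp add: w_def)
    have "lower_terms r m A w i t = volterra r m A u i t" if "i < m" "t \<in> {a..b}" for i t
      using that d by (simp add: lower_terms_def volterra_def)
    then have sol: "solves_ode a b r m A g w"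
      unfolding solves_ode_iff using eq d[of r] by simp
    have init: "\<forall>s<r. \<forall>i<m. hderiv a b s (w i) a = 0"
      using d[of _ _ a] ab by (simp add: prim_pow_at_left)
    have "cnorm a b n (w i) \<le> D ^ r * C * cvnorm a b ?l m g" if "i < m" for i
    proof -
      have "cnorm a b n (w i) \<le> D ^ r * cnorm a b ?l (u i)"
        using cnorm_prim_pow_le[of ?l "u i" r] reg that n by (simp add: w_def D_def)
      also have "\<dots> \<le> D ^ r * (C * cvnorm a b ?l m g)"
        using reg that D by (intro mult_left_mono) auto
      finally show ?thesis by (simp add: mult.assoc)
    qed
    then have "cvnorm a b n m w \<le> (\<Sum>i<m. D ^ r * C * cvnorm a b ?l m g)"
      unfolding cvnorm_def[of a b n m w] by (intro sum_mono) auto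
    then show ?thesis using w sol init by (intro bexI[of _ w]) (auto simp: mult.assoc)
  qed
  moreover have "0 \<le> real m * (D ^ r * C)" using C D by simp
  ultimately show ?thesis by blast
qed

text \<open>The difference has zero initial data, so it is the \<open>r\<close>-fold primitive of
  its \<open>r\<close>-th derivative. That derivative solves the homogeneous Volterra equation and
  vanishes by \<open>volterra_bound\<close>.\<close>

lemma ivp_unique:
  assumes A: "\<And>s. s < r \<Longrightarrow> A s \<in> Cmat a b (n - r) m" and r: "r \<le> n"
    and x: "x \<in> Cvec a b n m" and y: "y \<in> Cvec a b n m"
    and sol: "solves_ode a b r m A f x" "solves_ode a b r m A f y"
    and init: "\<And>s i. s < r \<Longrightarrow> i < m \<Longrightarrow> hderiv a b s (x i) a = hderiv a b s (y i) a"
  shows "x = y"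
proof -
  define w where "w i t = x i t - y i t" for i t
  have w: "w \<in> Cvec a b n m" unfolding w_def using x y by (rule Cvec_diff)
  have "solves_ode a b r m A (\<lambda>i t. 0) w"
    using solves_ode_diff[OF x y r sol] by (simp add: w_def[abs_def])
  then have ode: "hderiv a b r (w i) t + lower_terms r m A w i t = 0" if "i < m" "t \<in> {a..b}" for i t
    using that by (simp add: solves_ode_iff)
  have w0: "hderiv a b s (w i) a = 0" if "s < r" "i < m" for s i
  proof -
    have "hderiv a b s (\<lambda>t. x i t - y i t) a = hderiv a b s (x i) a - hderiv a b s (y i) a"
      by (rule hderiv_diff[of n]) (use x y that r ab in \<open>auto intro: CvecD\<close>)
    then show ?thesis using init that by (simp add: w_def[abs_def])
  qed
  let ?u = "\<lambda>i. hderiv a b r (w i)"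
  have Cw: "Cl a b r (w i)" if "i < m" for i
    using Cl_mono[OF CvecD[OF w that] r] .
  have u: "continuous_on {a..b} (?u i)" if "i < m" for i
    using continuous_on_hderiv[OF Cw[OF that]] by simp
  have wu: "w i t = (prim ^^ r) (?u i) t" if "i < m" "t \<in> {a..b}" for i t
    by (rule eq_prim_pow_hderiv) (use Cw w0 that in auto)
  have d: "hderiv a b s (w i) t = (prim ^^ (r - s)) (?u i) t" if "s < r" "i < m" "t \<in> {a..b}" for s i t
    using hderiv_cong[of "w i" "(prim ^^ r) (?u i)" t s, OF wu] hderiv_prim_pow[OF u, of i t s "r - s"] that by simp
  have volt: "?u i t + volterra r m A ?u i t = 0" if "i < m" "t \<in> {a..b}" for i t
    using ode[OF that] d that by (simp add: lower_terms_def volterra_def)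
  define M where "M = (\<Sum>s<r. cmnorm a b (n - r) m (A s))"
  have M: "cmnorm a b (n - r) m (A s) \<le> M" if "s < r" for s
    unfolding M_def by (rule member_le_sum) (use that A in \<open>auto intro: cmnorm_nonneg\<close>)
  have "0 \<le> M" unfolding M_def by (intro sum_nonneg) (use A in \<open>auto intro: cmnorm_nonneg\<close>)
  have u0: "?u i t = 0" if "i < m" "t \<in> {a..b}" for i t
  proof -
    have "norm (?u i t) \<le> 2 * exp (bielecki_rate r m M * (b - a)) * 0"
      by (rule volterra_bound[where A = A and u = ?u and g = "\<lambda>i t. 0"])
        (use norm_coeff_le[OF A M] \<open>0 \<le> M\<close> u volt that in auto)
    then show ?thesis by simp
  qed
  \<comment> \<open>The zero function is written as \<open>0 * 0\<close> to match
    \<open>prim_pow_cmult\<close> with factor 0.\<close>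
  have "w i t = 0" if "i < m" "t \<in> {a..b}" for i t
    using wu[OF that] prim_pow_cong[of "?u i" "\<lambda>t. 0 * 0" t r] u0 prim_pow_cmult[of r 0 "\<lambda>t. 0"] that by simp
  then show ?thesis
    using x y by (intro Cvec_eqI[of x n m y n]) (auto simp: w_def)
qed

text \<open>Passage between two operators with initial data and right-hand side preserved. It is
  used from \<open>A\<close> to the approximating coefficients, where the bound matters, and back,
  where only existence does.\<close>

lemma ivp_transfer:
  assumes r: "1 \<le> r" "r \<le> n" and M: "0 \<le> M"
  shows "\<exists>C\<ge>0. \<forall>A A' z. (\<forall>s<r. A s \<in> Cmat a b (n - r) m) \<longrightarrow>
    (\<forall>s<r. A' s \<in> Cmat a b (n - r) m \<and> cmnorm a b (n - r) m (A' s) \<le> M) \<longrightarrow> z \<in> Cvec a b n m \<longrightarrow>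
    (\<exists>v\<in>Cvec a b n m. (\<forall>f. solves_ode a b r m A f z \<longrightarrow> solves_ode a b r m A' f v) \<and>
      (\<forall>s<r. \<forall>i<m. hderiv a b s (v i) a = hderiv a b s (z i) a) \<and>
      cvnorm a b n m (\<lambda>i t. v i t - z i t) \<le>
        C * (\<Sum>s<r. cmnorm a b (n - r) m (\<lambda>i j t. A s i j t - A' s i j t)) * cvnorm a b n m z)"
proof -
  let ?l = "n - r"
  obtain C where C: "0 \<le> C" and ivp: "\<And>A g. (\<forall>s<r. A s \<in> Cmat a b ?l m \<and> cmnorm a b ?l m (A s) \<le> M) \<Longrightarrow>
    g\<in>Cvec a b ?l m \<Longrightarrow> \<exists>w\<in>Cvec a b n m. solves_ode a b r m A g w \<and>
      (\<forall>s<r. \<forall>i<m. hderiv a b s (w i) a = 0) \<and> cvnorm a b n m w \<le> C * cvnorm a b ?l m g"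
    using ivp_solvable[OF r M, of m] by metis
  have "\<exists>v\<in>Cvec a b n m. (\<forall>f. solves_ode a b r m A f z \<longrightarrow> solves_ode a b r m A' f v) \<and>
      (\<forall>s<r. \<forall>i<m. hderiv a b s (v i) a = hderiv a b s (z i) a) \<and>
      cvnorm a b n m (\<lambda>i t. v i t - z i t) \<le>
        (C * 2 ^ ?l) * (\<Sum>s<r. cmnorm a b ?l m (\<lambda>i j t. A s i j t - A' s i j t)) * cvnorm a b n m z"
    if A: "\<forall>s<r. A s \<in> Cmat a b ?l m"
      and A': "\<forall>s<r. A' s \<in> Cmat a b ?l m \<and> cmnorm a b ?l m (A' s) \<le> M" and z: "z \<in> Cvec a b n m"
    for A A' z
  proof -
    \<comment> \<open>At \<open>z\<close> the operator with coefficients \<open>A'\<close> falls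
      short of the one with \<open>A\<close> by \<open>g\<close>; the correction \<open>w\<close>
      with zero initial data restores it.\<close>
    define g where "g = lower_terms r m (\<lambda>s i j t. A s i j t - A' s i j t) z"
    have dA: "(\<lambda>i j t. A s i j t - A' s i j t) \<in> Cmat a b ?l m" if "s < r" for s
      using A A' that by (intro Cmat_diff) auto
    have g: "g \<in> Cvec a b ?l m"
      "cvnorm a b ?l m g \<le> 2 ^ ?l * (\<Sum>s<r. cmnorm a b ?l m (\<lambda>i j t. A s i j t - A' s i j t)) * cvnorm a b n m z"
      unfolding g_def using lower_terms_Cvec[OF dA z r(2)] by auto
    obtain w where w: "w \<in> Cvec a b n m" and sol: "solves_ode a b r m A' g w"
      and init: "\<forall>s<r. \<forall>i<m. hderiv a b s (w i) a = 0" and wb: "cvnorm a b n m w \<le> C * cvnorm a b ?l m g"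
      using ivp[OF A' g(1)] by blast
    define v where "v = (\<lambda>i t. z i t + w i t)"
    have "v \<in> Cvec a b n m" unfolding v_def using z w by (rule Cvec_add)
    moreover have "solves_ode a b r m A' f v" if f: "solves_ode a b r m A f z" for f
    proof -
      have "solves_ode a b r m A' (\<lambda>i t. f i t - g i t) z"
        using f unfolding solves_ode_iff g_def lower_terms_diff_coeff
        proof (intro allI impI ballI)
          fix i t assume "\<forall>i<m. \<forall>t\<in>{a..b}. hderiv a b r (z i) t + lower_terms r m A z i t = f i t"
            "i < m" "t \<in> {a..b}"
          then have "f i t = hderiv a b r (z i) t + lower_terms r m A z i t" by simp
          then show "hderiv a b r (z i) t + lower_terms r m A' z i t =
              f i t - (lower_terms r m A z i t - lower_terms r m A' z i t)" by simp
        qed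
      from solves_ode_add[OF z w r(2) this sol] show ?thesis by (simp add: v_def)
    qed
    moreover have "hderiv a b s (v i) a = hderiv a b s (z i) a" if "s < r" "i < m" for s i
    proof -
      have "hderiv a b s (\<lambda>t. z i t + w i t) a = hderiv a b s (z i) a + hderiv a b s (w i) a"
        by (rule hderiv_add[of n]) (use z w that r ab in \<open>auto intro: CvecD\<close>)
      then show ?thesis using init that by (simp add: v_def)
    qed
    moreover have "cvnorm a b n m (\<lambda>i t. v i t - z i t) \<le>
        (C * 2 ^ ?l) * (\<Sum>s<r. cmnorm a b ?l m (\<lambda>i j t. A s i j t - A' s i j t)) * cvnorm a b n m z"
    proof -
      have "(\<lambda>i t. v i t - z i t) = w" by (simp add: v_def)
      then show ?thesis using order_trans[OF wb mult_left_mono[OF g(2) C]] by (simp add: mult_ac)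
    qed
    ultimately show ?thesis by blast
  qed
  moreover have "0 \<le> C * 2 ^ ?l" using C by simp
  ultimately show ?thesis by blast
qed

subsection \<open>Approximation by multipoint functionals\<close>

definition node :: "nat \<Rightarrow> nat \<Rightarrow> real" where
  "node k j = a + real j / real k * (b - a)"

definition bern :: "nat \<Rightarrow> nat \<Rightarrow> real \<Rightarrow> complex" where
  "bern k j t = of_real (Bernstein k j ((t - a) / (b - a)))"

definition bernstein_approx :: "nat \<Rightarrow> (real \<Rightarrow> complex) \<Rightarrow> real \<Rightarrow> complex" where
  "bernstein_approx k x t = (\<Sum>j\<le>k. x (node k j) * bern k j t)"

lemma node_in: "j \<le> k \<Longrightarrow> node k j \<in> {a..b}"
proof -
  assume "j \<le> k"
  \<comment> \<open>For \<open>k = 0\<close> the quotient is 0 by convention, and the only node is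
    \<open>a\<close>.\<close>
  then have "real j / real k \<le> 1" by (cases "k = 0") auto
  then have "real j / real k * (b - a) \<le> 1 * (b - a)" using ab by (intro mult_right_mono) auto
  then show ?thesis using ab by (simp add: node_def)
qed

lemma continuous_on_bern: "continuous_on S (bern k j)"
  unfolding bern_def Bernstein_def by (intro continuous_intros) (use ab in auto)

lemma continuous_on_bernstein_approx: "continuous_on S (bernstein_approx k x)"
  unfolding bernstein_approx_def by (intro continuous_intros continuous_on_bern)

lemma norm_bernstein_approx_le:
  assumes "\<And>t. t \<in> {a..b} \<Longrightarrow> norm (x t) \<le> K" and t: "t \<in> {a..b}"
  shows "norm (bernstein_approx k x t) \<le> K"
proof -
  let ?s = "(t - a) / (b - a)"
  have s: "0 \<le> ?s" "?s \<le> 1" using t ab by auto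
  have "norm (bernstein_approx k x t) \<le> (\<Sum>j\<le>k. norm (x (node k j)) * Bernstein k j ?s)"
    unfolding bernstein_approx_def bern_def using Bernstein_nonneg[OF s]
    by (intro order_trans[OF norm_sum] sum_mono) (simp add: norm_mult)
  also have "\<dots> \<le> (\<Sum>j\<le>k. K * Bernstein k j ?s)"
    using assms node_in Bernstein_nonneg[OF s] by (intro sum_mono mult_right_mono) auto
  finally show ?thesis by (simp add: sum_distrib_left[symmetric])
qed

text \<open>The Bernstein-Weierstrass theorem for real and imaginary parts after an affine change of
  variable. Errors below \<open>e / 4\<close> add up to at most \<open>e / 2\<close>, which keeps
  the supremum strictly below \<open>e\<close>.\<close>

lemma bernstein_approx_tendsto:
  assumes x: "continuous_on {a..b} x"
  shows "(\<lambda>k. cnorm a b 0 (\<lambda>t. bernstein_approx k x t - x t)) \<longlonglongrightarrow> 0"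
proof (rule LIMSEQ_I)
  fix e :: real assume e: "0 < e"
  have in_ab: "a + s * (b - a) \<in> {a..b}" if "s \<in> {0..1}" for s
    using that ab mult_left_le_one_le[of "b - a" s] by (auto simp: add.commute[of a] le_diff_eq[symmetric])
  have x': "continuous_on {0..1} (\<lambda>s. x (a + s * (b - a)))"
    by (rule continuous_on_compose2[OF x]) (use in_ab in \<open>auto intro!: continuous_intros\<close>)
  obtain N1 where N1: "\<And>k s. N1 \<le> k \<Longrightarrow> s \<in> {0..1} \<Longrightarrow>
      \<bar>Re (x (a + s * (b - a))) - (\<Sum>j\<le>k. Re (x (a + real j / real k * (b - a))) * Bernstein k j s)\<bar> < e / 4"
    using Bernstein_Weierstrass[OF continuous_on_Re[OF x'], of "e / 4"] e by auto
  obtain N2 where N2: "\<And>k s. N2 \<le> k \<Longrightarrow> s \<in> {0..1} \<Longrightarrow>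
      \<bar>Im (x (a + s * (b - a))) - (\<Sum>j\<le>k. Im (x (a + real j / real k * (b - a))) * Bernstein k j s)\<bar> < e / 4"
    using Bernstein_Weierstrass[OF continuous_on_Im[OF x'], of "e / 4"] e by auto
  have "norm (cnorm a b 0 (\<lambda>t. bernstein_approx k x t - x t) - 0) < e" if k: "max N1 N2 \<le> k" for k
  proof -
    have "norm (bernstein_approx k x t - x t) \<le> e / 2" if t: "t \<in> {a..b}" for t
    proof -
      let ?s = "(t - a) / (b - a)"
      have s: "?s \<in> {0..1}" "a + ?s * (b - a) = t" using t ab by auto
      have "\<bar>Re (bernstein_approx k x t - x t)\<bar> < e / 4"
        using N1[of k ?s] k s by (simp add: bernstein_approx_def bern_def node_def abs_minus_commute)
      moreover have "\<bar>Im (bernstein_approx k x t - x t)\<bar> < e / 4"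
        using N2[of k ?s] k s by (simp add: bernstein_approx_def bern_def node_def abs_minus_commute)
      ultimately show ?thesis
        using cmod_le[of "bernstein_approx k x t - x t"] by linarith
    qed
    then have "cnorm a b 0 (\<lambda>t. bernstein_approx k x t - x t) \<le> e / 2" by (rule cnorm_0_le)
    moreover have "0 \<le> cnorm a b 0 (\<lambda>t. bernstein_approx k x t - x t)"
      by (intro cnorm_0_nonneg continuous_intros continuous_on_bernstein_approx x)
    ultimately show ?thesis using e by simp
  qed
  then show "\<exists>no. \<forall>k\<ge>no. norm (cnorm a b 0 (\<lambda>t. bernstein_approx k x t - x t) - 0) < e" by blast
qed

text \<open>The interpolant of \<open>x\<close> is its Taylor polynomial of degree less than \<open>n\<close> at \<open>a\<close> plus the
  \<open>n\<close>-fold primitive of the Bernstein polynomial of the \<open>n\<close>-th derivative. It is written as one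
  double sum over nodes \<open>j \<ge> 1\<close> and derivative orders \<open>l\<close>, to match the form of multipoint
  conditions; the node of index 1 is \<open>a\<close> and carries the Taylor coefficients.\<close>

definition interp_basis :: "nat \<Rightarrow> nat \<Rightarrow> nat \<Rightarrow> nat \<Rightarrow> real \<Rightarrow> complex" where
  "interp_basis n k j l t =
    (if t \<notin> {a..b} then 0
     else if l = n then (prim ^^ n) (bern k (j - 1)) t
     else if j = 1 then (prim ^^ l) (\<lambda>_. 1) t else 0)"

definition interp :: "nat \<Rightarrow> nat \<Rightarrow> (real \<Rightarrow> complex) \<Rightarrow> real \<Rightarrow> complex" where
  "interp n k x t = (\<Sum>j=1..Suc k. \<Sum>l\<le>n. hderiv a b l x (node k (j - 1)) * interp_basis n k j l t)"

lemma Cl_interp_basis: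
  assumes "l \<le> n"
  shows "Cl a b n (interp_basis n k j l)"
proof -
  have bern: "Cl a b n ((prim ^^ n) (bern k (j - 1)))"
    using Cl_prim_pow[of 0 "bern k (j - 1)" n] by (simp add: Cl_0 continuous_on_bern)
  have taylor: "Cl a b n ((prim ^^ l) (\<lambda>_. 1))"
    using Cl_prim_pow[of "n - l" "\<lambda>_. 1" l] Cl_const assms by simp
  consider "l = n" | "l \<noteq> n" "j = 1" | "l \<noteq> n" "j \<noteq> 1" by blast
  then show ?thesis
  proof cases
    case 1
    have "interp_basis n k j l t = (prim ^^ n) (bern k (j - 1)) t" if "t \<in> {a..b}" for t
      using that 1 by (simp add: interp_basis_def)
    from Cl_cong[OF this] show ?thesis using bern by simp
  next
    case 2
    have "interp_basis n k j l t = (prim ^^ l) (\<lambda>_. 1) t" if "t \<in> {a..b}" for t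
      using that 2 by (simp add: interp_basis_def)
    from Cl_cong[OF this] show ?thesis using taylor by simp
  next
    case 3
    have "interp_basis n k j l = (\<lambda>t. 0)"
      using 3 by (simp add: interp_basis_def fun_eq_iff)
    then show ?thesis by (simp add: Cl_zero)
  qed
qed

text \<open>The Taylor parts cancel, so the error is an \<open>n\<close>-fold primitive of a
  Bernstein error. Boundedness and convergence in \<open>C\<^sup>n\<close> thereby reduce to the
  supremum norm of Bernstein polynomials.\<close>

lemma interp_minus_eq:
  assumes x: "Cl a b n x" and t: "t \<in> {a..b}"
  shows "interp n k x t - x t =
    (prim ^^ n) (\<lambda>t. bernstein_approx k (hderiv a b n x) t - hderiv a b n x t) t"
proof -
  have c: "continuous_on {a..b} (hderiv a b n x)" using continuous_on_hderiv[OF x] by simp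
  have split_last: "(\<Sum>l\<le>n. F l) = (\<Sum>l<n. F l) + F n" for F :: "nat \<Rightarrow> complex"
    by (simp only: lessThan_Suc_atMost[symmetric] sum.lessThan_Suc)
  have n0: "node k 0 = a" by (simp add: node_def)
  have "interp n k x t =
      (\<Sum>j=1..Suc k. (\<Sum>l<n. hderiv a b l x (node k (j - 1)) * interp_basis n k j l t)
        + hderiv a b n x (node k (j - 1)) * (prim ^^ n) (bern k (j - 1)) t)"
    unfolding interp_def split_last using t by (intro sum.cong refl) (simp add: interp_basis_def)
  also have "\<dots> = (\<Sum>j=1..Suc k. \<Sum>l<n. hderiv a b l x (node k (j - 1)) * interp_basis n k j l t)
        + (\<Sum>j=1..Suc k. hderiv a b n x (node k (j - 1)) * (prim ^^ n) (bern k (j - 1)) t)"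
    by (rule sum.distrib)
  \<comment> \<open>For orders \<open>l < n\<close> only the index \<open>j = 1\<close>, whose node
    is \<open>a\<close>, has a nonzero basis function.\<close>
  also have "(\<Sum>j=1..Suc k. \<Sum>l<n. hderiv a b l x (node k (j - 1)) * interp_basis n k j l t) =
      (\<Sum>j=1..Suc k. if j = 1 then \<Sum>l<n. hderiv a b l x a * (prim ^^ l) (\<lambda>_. 1) t else 0)"
    using t by (intro sum.cong refl) (auto simp: interp_basis_def n0)
  also have "\<dots> = (\<Sum>l<n. hderiv a b l x a * (prim ^^ l) (\<lambda>_. 1) t)"
    by (simp add: sum.delta)
  also have "(\<Sum>j=1..Suc k. hderiv a b n x (node k (j - 1)) * (prim ^^ n) (bern k (j - 1)) t) =
      (\<Sum>j\<le>k. hderiv a b n x (node k j) * (prim ^^ n) (bern k j) t)"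
    by (rule sum.reindex_bij_witness[where i = Suc and j = "\<lambda>j. j - 1"]) auto
  also have "\<dots> = (prim ^^ n) (bernstein_approx k (hderiv a b n x)) t"
    unfolding bernstein_approx_def
    by (subst prim_pow_sum) (auto intro!: continuous_intros continuous_on_bern simp: prim_pow_cmult)
  finally show ?thesis
    using Taylor_prim[OF x t] prim_pow_diff[OF continuous_on_bernstein_approx c, of n k "hderiv a b n x"] by simp
qed

lemma Cl_interp: "Cl a b n (interp n k x)"
  unfolding interp_def[abs_def] by (intro Cl_sum Cl_cmult Cl_interp_basis) auto

lemma cnorm_interp_minus_le:
  assumes x: "Cl a b n x"
  shows "cnorm a b n (\<lambda>t. interp n k x t - x t) \<le>
    (1 + (b - a)) ^ n * cnorm a b 0 (\<lambda>t. bernstein_approx k (hderiv a b n x) t - hderiv a b n x t)"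
proof -
  have "Cl a b 0 (\<lambda>t. bernstein_approx k (hderiv a b n x) t - hderiv a b n x t)"
    unfolding Cl_0 by (intro continuous_intros continuous_on_bernstein_approx continuous_on_hderiv[OF x]) simp
  from cnorm_prim_pow_le[OF this, of n] show ?thesis
    by (subst cnorm_cong[OF interp_minus_eq[OF x]]) auto
qed

text \<open>Bernstein polynomials do not exceed a bound for the function, so the constant is
  independent of \<open>k\<close>.\<close>

lemma cnorm_interp_minus_bound:
  assumes x: "Cl a b n x"
  shows "cnorm a b n (\<lambda>t. interp n k x t - x t) \<le> (1 + (b - a)) ^ n * 2 * cnorm a b n x"
proof -
  have h: "norm (hderiv a b n x t) \<le> cnorm a b n x" if "t \<in> {a..b}" for t
    using norm_hderiv_le_cnorm[OF x order_refl that] .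
  have "norm (bernstein_approx k (hderiv a b n x) t - hderiv a b n x t) \<le> 2 * cnorm a b n x"
    if t: "t \<in> {a..b}" for t
    using norm_triangle_ineq4[of "bernstein_approx k (hderiv a b n x) t" "hderiv a b n x t"]
      norm_bernstein_approx_le[of "hderiv a b n x", OF h t, of k] h[OF t] by linarith
  then have "cnorm a b 0 (\<lambda>t. bernstein_approx k (hderiv a b n x) t - hderiv a b n x t) \<le> 2 * cnorm a b n x"
    by (rule cnorm_0_le)
  then have "(1 + (b - a)) ^ n * cnorm a b 0 (\<lambda>t. bernstein_approx k (hderiv a b n x) t - hderiv a b n x t)
      \<le> (1 + (b - a)) ^ n * (2 * cnorm a b n x)"
    using ab by (intro mult_left_mono) auto
  then show ?thesis using cnorm_interp_minus_le[OF x, of k] by simp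
qed

lemma interp_tendsto:
  assumes x: "Cl a b n x"
  shows "(\<lambda>k. cnorm a b n (\<lambda>t. interp n k x t - x t)) \<longlonglongrightarrow> 0"
proof (rule tendsto_sandwich[where f = "\<lambda>_. 0"])
  show "\<forall>\<^sub>F k in sequentially. 0 \<le> cnorm a b n (\<lambda>t. interp n k x t - x t)"
    by (intro always_eventually allI cnorm_nonneg Cl_diff Cl_interp x)
  show "\<forall>\<^sub>F k in sequentially. cnorm a b n (\<lambda>t. interp n k x t - x t) \<le>
      (1 + (b - a)) ^ n * cnorm a b 0 (\<lambda>t. bernstein_approx k (hderiv a b n x) t - hderiv a b n x t)"
    by (intro always_eventually allI cnorm_interp_minus_le x)
  show "(\<lambda>k. (1 + (b - a)) ^ n *
      cnorm a b 0 (\<lambda>t. bernstein_approx k (hderiv a b n x) t - hderiv a b n x t)) \<longlonglongrightarrow> 0"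
    by (intro tendsto_mult_right_zero bernstein_approx_tendsto continuous_on_hderiv[OF x] order_refl)
qed simp

lemma interp_diff:
  assumes "Cl a b n x" and "Cl a b n y"
  shows "interp n k (\<lambda>t. x t - y t) t = interp n k x t - interp n k y t"
  unfolding interp_def sum_subtractf[symmetric] left_diff_distrib[symmetric]
proof (intro sum.cong refl)
  fix j l assume "j \<in> {1..Suc k}" and "l \<in> {..n}"
  then have "node k (j - 1) \<in> {a..b}" "l \<le> n" using node_in[of "j - 1" k] by auto
  then show "hderiv a b l (\<lambda>t. x t - y t) (node k (j - 1)) * interp_basis n k j l t =
    (hderiv a b l x (node k (j - 1)) - hderiv a b l y (node k (j - 1))) * interp_basis n k j l t"
    using hderiv_diff[OF assms] by simp
qed

section \<open>Interpolation of vector functions\<close>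

definition unit_basis :: "nat \<Rightarrow> nat \<Rightarrow> nat \<Rightarrow> nat \<Rightarrow> nat \<Rightarrow> nat \<Rightarrow> nat \<Rightarrow> real \<Rightarrow> complex" where
  "unit_basis n m k j l c i t = (if i = c \<and> c < m then interp_basis n k j l t else 0)"

definition vinterp :: "nat \<Rightarrow> nat \<Rightarrow> nat \<Rightarrow> (nat \<Rightarrow> real \<Rightarrow> complex) \<Rightarrow> nat \<Rightarrow> real \<Rightarrow> complex" where
  "vinterp n m k y i t = (if i < m then interp n k (y i) t else 0)"

text \<open>The guard \<open>c < m\<close> in \<open>unit_basis\<close> gives membership for every
  \<open>c\<close>. Thus \<open>B\<close> may be applied to these functions; its values are the
  entries of the multipoint matrices.\<close>

lemma unit_basis_Cvec: "l \<le> n \<Longrightarrow> unit_basis n m k j l c \<in> Cvec a b n m"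
proof -
  assume l: "l \<le> n"
  have "unit_basis n m k j l c i = (if i = c \<and> c < m then interp_basis n k j l else (\<lambda>t. 0))" for i
    by (auto simp: unit_basis_def)
  then have "Cl a b n (unit_basis n m k j l c i)" for i
    using Cl_interp_basis[OF l] Cl_zero by simp
  then show ?thesis by (auto simp: Cvec_def unit_basis_def interp_basis_def)
qed

lemma vinterp_Cvec: "vinterp n m k y \<in> Cvec a b n m"
proof -
  have "vinterp n m k y i = interp n k (y i)" if "i < m" for i
    using that by (simp add: vinterp_def fun_eq_iff)
  then show ?thesis
    using Cl_interp by (auto simp: Cvec_def vinterp_def interp_def interp_basis_def)
qed

text \<open>A finite combination of fixed functions whose coefficients are point values of
  derivatives of \<open>y\<close>. A linear operator applied to it yields a multipoint
  expression.\<close>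

lemma vinterp_eq_sum:
  "vinterp n m k y i t = (\<Sum>(j, l, c)\<in>{1..Suc k} \<times> {..n} \<times> {..<m}.
     hderiv a b l (y c) (node k (j - 1)) * unit_basis n m k j l c i t)"
proof -
  have "(\<Sum>c<m. hderiv a b l (y c) (node k (j - 1)) * unit_basis n m k j l c i t) =
      (if i < m then hderiv a b l (y i) (node k (j - 1)) * interp_basis n k j l t else 0)" for j l
  proof -
    have "(\<Sum>c<m. hderiv a b l (y c) (node k (j - 1)) * unit_basis n m k j l c i t) =
      (\<Sum>c<m. if c = i then hderiv a b l (y c) (node k (j - 1)) * interp_basis n k j l t else 0)"
      by (intro sum.cong) (auto simp: unit_basis_def)
    then show ?thesis by (simp add: sum.delta)
  qed
  then show ?thesis
    by (simp add: vinterp_def interp_def sum.cartesian_product[symmetric] del: sum.cl_ivl_Suc)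
qed

lemma cvnorm_vinterp_minus_bound:
  assumes "y \<in> Cvec a b n m"
  shows "cvnorm a b n m (\<lambda>i t. vinterp n m k y i t - y i t) \<le> (1 + (b - a)) ^ n * 2 * cvnorm a b n m y"
  unfolding cvnorm_def sum_distrib_left
proof (intro sum_mono)
  fix i assume "i \<in> {..<m}"
  then show "cnorm a b n (\<lambda>t. vinterp n m k y i t - y i t) \<le> (1 + (b - a)) ^ n * 2 * cnorm a b n (y i)"
    using cnorm_interp_minus_bound[OF CvecD[OF assms]] by (simp add: vinterp_def)
qed

lemma vinterp_tendsto:
  assumes "y \<in> Cvec a b n m"
  shows "(\<lambda>k. cvnorm a b n m (\<lambda>i t. vinterp n m k y i t - y i t)) \<longlonglongrightarrow> 0"
  unfolding cvnorm_def
proof (intro tendsto_null_sum)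
  fix i assume "i \<in> {..<m}"
  then show "(\<lambda>k. cnorm a b n (\<lambda>t. vinterp n m k y i t - y i t)) \<longlonglongrightarrow> 0"
    using interp_tendsto[OF CvecD[OF assms]] by (simp add: vinterp_def)
qed

lemma vinterp_diff:
  assumes "x \<in> Cvec a b n m" and "y \<in> Cvec a b n m"
  shows "vinterp n m k (\<lambda>i t. x i t - y i t) = (\<lambda>i t. vinterp n m k x i t - vinterp n m k y i t)"
  using interp_diff CvecD[OF assms(1)] CvecD[OF assms(2)] by (auto simp: vinterp_def fun_eq_iff)

text \<open>Uniform boundedness of the interpolation operators upgrades pointwise convergence to
  convergence along a convergent sequence of arguments.\<close>

lemma vinterp_tendsto_along:
  assumes v: "\<And>k. v k \<in> Cvec a b n m" and z: "z \<in> Cvec a b n m"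
    and lim: "(\<lambda>k. cvnorm a b n m (\<lambda>i t. v k i t - z i t)) \<longlonglongrightarrow> 0"
  shows "(\<lambda>k. cvnorm a b n m (\<lambda>i t. vinterp n m k (v k) i t - z i t)) \<longlonglongrightarrow> 0"
proof (rule tendsto_sandwich[where f = "\<lambda>_. 0"])
  let ?K = "(1 + (b - a)) ^ n * 2"
  let ?d = "\<lambda>k i t. v k i t - z i t"
  show "\<forall>\<^sub>F k in sequentially. 0 \<le> cvnorm a b n m (\<lambda>i t. vinterp n m k (v k) i t - z i t)"
    by (intro always_eventually allI cvnorm_nonneg Cvec_diff vinterp_Cvec z)
  have "cvnorm a b n m (\<lambda>i t. vinterp n m k (v k) i t - z i t) \<le>
      ?K * cvnorm a b n m (?d k) + (cvnorm a b n m (\<lambda>i t. vinterp n m k z i t - z i t) + cvnorm a b n m (?d k))" for k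
  proof -
    have d: "?d k \<in> Cvec a b n m" by (intro Cvec_diff v z)
    \<comment> \<open>The interpolation error of the difference is controlled by the uniform bound,
      that of the fixed \<open>z\<close> by pointwise convergence.\<close>
    have "(\<lambda>i t. vinterp n m k (v k) i t - z i t) =
        (\<lambda>i t. (vinterp n m k (?d k) i t - ?d k i t) + ((vinterp n m k z i t - z i t) + ?d k i t))"
      unfolding vinterp_diff[OF v z] by simp
    then have "cvnorm a b n m (\<lambda>i t. vinterp n m k (v k) i t - z i t) \<le>
        cvnorm a b n m (\<lambda>i t. vinterp n m k (?d k) i t - ?d k i t) +
        (cvnorm a b n m (\<lambda>i t. vinterp n m k z i t - z i t) + cvnorm a b n m (?d k))"
      by (simp only:) (intro order_trans[OF cvnorm_add_le] add_left_mono cvnorm_add_le Cvec_add Cvec_diff vinterp_Cvec v z)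
    then show ?thesis using cvnorm_vinterp_minus_bound[OF d, of k] by linarith
  qed
  then show "\<forall>\<^sub>F k in sequentially. cvnorm a b n m (\<lambda>i t. vinterp n m k (v k) i t - z i t) \<le>
      ?K * cvnorm a b n m (?d k) + (cvnorm a b n m (\<lambda>i t. vinterp n m k z i t - z i t) + cvnorm a b n m (?d k))"
    by simp
  show "(\<lambda>k. ?K * cvnorm a b n m (?d k) +
      (cvnorm a b n m (\<lambda>i t. vinterp n m k z i t - z i t) + cvnorm a b n m (?d k))) \<longlonglongrightarrow> 0"
    by (intro tendsto_add_zero tendsto_mult_right_zero lim vinterp_tendsto z)
qed simp

section \<open>The boundary operator composed with interpolation\<close>

lemma bop_add:
  "cont_linear_bop a b n m N B \<Longrightarrow> y \<in> Cvec a b n m \<Longrightarrow> z \<in> Cvec a b n m \<Longrightarrow> i < N \<Longrightarrow>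
    B (\<lambda>i t. y i t + z i t) i = B y i + B z i"
  by (simp add: cont_linear_bop_def)

lemma bop_cmult:
  "cont_linear_bop a b n m N B \<Longrightarrow> y \<in> Cvec a b n m \<Longrightarrow> i < N \<Longrightarrow> B (\<lambda>i t. c * y i t) i = c * B y i"
  by (simp add: cont_linear_bop_def)

lemma bop_lincomb:
  assumes B: "cont_linear_bop a b n m N B" and "\<And>k. k \<in> S \<Longrightarrow> y k \<in> Cvec a b n m" and i: "i < N"
    and "finite S"
  shows "B (\<lambda>i t. \<Sum>k\<in>S. c k * y k i t) i = (\<Sum>k\<in>S. c k * B (y k) i)"
  using assms(4,2)
proof (induction S rule: finite_induct)
  case empty
  then show ?case using bop_cmult[OF B Cvec_zero i, of 0] by simp
next
  case (insert k S)
  then show ?case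
    using bop_add[OF B Cvec_cmult[of "y k"] Cvec_sum[of S "\<lambda>k i t. c k * y k i t"] i] bop_cmult[OF B _ i, of "y k" "c k"]
    by (simp add: Cvec_cmult)
qed

lemma bop_tendsto:
  assumes B: "cont_linear_bop a b n m N B" and y: "\<And>k. y k \<in> Cvec a b n m" and z: "z \<in> Cvec a b n m"
    and lim: "(\<lambda>k. cvnorm a b n m (\<lambda>i t. y k i t - z i t)) \<longlonglongrightarrow> 0" and i: "i < N"
  shows "(\<lambda>k. B (y k) i) \<longlonglongrightarrow> B z i"
proof (rule tendstoI)
  fix e :: real assume "0 < e"
  then obtain d where "0 < d" and d: "\<And>y. y \<in> Cvec a b n m \<Longrightarrow>
      cvnorm a b n m (\<lambda>i t. y i t - z i t) < d \<Longrightarrow> (\<Sum>i<N. norm (B y i - B z i)) < e"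
    using conjunct2[OF conjunct2[OF B[unfolded cont_linear_bop_def]], rule_format, OF z] by blast
  have "\<forall>\<^sub>F k in sequentially. cvnorm a b n m (\<lambda>i t. y k i t - z i t) < d"
    using lim \<open>0 < d\<close> by (rule order_tendstoD(2))
  then show "\<forall>\<^sub>F k in sequentially. dist (B (y k) i) (B z i) < e"
  proof (rule eventually_mono)
    fix k assume "cvnorm a b n m (\<lambda>i t. y k i t - z i t) < d"
    then have "(\<Sum>i<N. norm (B (y k) i - B z i)) < e" using d y by blast
    moreover have "norm (B (y k) i - B z i) \<le> (\<Sum>i<N. norm (B (y k) i - B z i))"
      by (rule member_le_sum) (use i in auto)
    ultimately show "dist (B (y k) i) (B z i) < e" by (simp add: dist_norm)
  qed
qed

text \<open>By linearity \<open>B\<close> passes to the basis functions, so \<open>B\<close> after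
  interpolation is a multipoint condition whose matrices depend only on \<open>B\<close> and
  \<open>k\<close>.\<close>

lemma multipoint_bc_iff:
  assumes B: "cont_linear_bop a b n m (r * m) B"
  shows "multipoint_bc a b n r m (Suc k) (\<lambda>j. node k (j - 1)) (\<lambda>j l i c. B (unit_basis n m k j l c) i) q y
    \<longleftrightarrow> (\<forall>i<r*m. B (vinterp n m k y) i = q i)"
proof -
  let ?S = "{1..Suc k} \<times> {..n} \<times> {..<m}"
  have "B (vinterp n m k y) i = (\<Sum>j=1..Suc k. \<Sum>l\<le>n. \<Sum>c<m.
      B (unit_basis n m k j l c) i * hderiv a b l (y c) (node k (j - 1)))" if i: "i < r * m" for i
  proof -
    have "B (vinterp n m k y) i = B (\<lambda>i t. \<Sum>p\<in>?S. (case p of (j, l, c) \<Rightarrow> hderiv a b l (y c) (node k (j - 1)))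
        * (case p of (j, l, c) \<Rightarrow> unit_basis n m k j l c) i t) i"
      unfolding vinterp_eq_sum[abs_def]
      by (intro arg_cong[of _ _ "\<lambda>y. B y i"] ext sum.cong) auto
    also have "\<dots> = (\<Sum>p\<in>?S. (case p of (j, l, c) \<Rightarrow> hderiv a b l (y c) (node k (j - 1)))
        * B (case p of (j, l, c) \<Rightarrow> unit_basis n m k j l c) i)"
      by (rule bop_lincomb[OF B _ i]) (auto intro: unit_basis_Cvec)
    also have "\<dots> = (\<Sum>(j, l, c)\<in>?S. B (unit_basis n m k j l c) i * hderiv a b l (y c) (node k (j - 1)))"
      by (intro sum.cong) (auto simp: mult.commute)
    finally show ?thesis by (simp add: sum.cartesian_product del: sum.cl_ivl_Suc)
  qed
  then show ?thesis unfolding multipoint_bc_def by simp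
qed

subsection \<open>Affine combinations of solutions\<close>

text \<open>The shape of the general solution: a particular solution \<open>y\<close> plus a
  combination of homogeneous solutions \<open>Y\<close>.\<close>

definition shift_comb ::
    "nat \<Rightarrow> (nat \<Rightarrow> real \<Rightarrow> complex) \<Rightarrow> (nat \<Rightarrow> complex) \<Rightarrow> (nat \<Rightarrow> nat \<Rightarrow> real \<Rightarrow> complex) \<Rightarrow> nat \<Rightarrow> real \<Rightarrow> complex"
  where "shift_comb N y c Y i t = y i t + (\<Sum>k<N. c k * Y k i t)"

lemma shift_comb_Cvec:
  "y \<in> Cvec a b n m \<Longrightarrow> (\<And>k. k < N \<Longrightarrow> Y k \<in> Cvec a b n m) \<Longrightarrow> shift_comb N y c Y \<in> Cvec a b n m"
  unfolding shift_comb_def[abs_def] by (intro Cvec_add Cvec_sum Cvec_cmult) auto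

lemma hderiv_shift_comb:
  assumes "y \<in> Cvec a b n m" and "\<And>k. k < N \<Longrightarrow> Y k \<in> Cvec a b n m"
    and "s \<le> n" and "i < m" and "t \<in> {a..b}"
  shows "hderiv a b s (shift_comb N y c Y i) t = hderiv a b s (y i) t + (\<Sum>k<N. c k * hderiv a b s (Y k i) t)"
proof -
  have C: "Cl a b n (y i)" "Cl a b n (\<lambda>t. c k * Y k i t)" "Cl a b n (Y k i)" if "k < N" for k
    using assms that by (auto intro: CvecD Cl_cmult)
  have "hderiv a b s (shift_comb N y c Y i) t = hderiv a b s (y i) t + hderiv a b s (\<lambda>t. \<Sum>k<N. c k * Y k i t) t"
    unfolding shift_comb_def[abs_def]
    by (rule hderiv_add[of n]) (use assms C in \<open>auto intro: CvecD Cl_sum\<close>)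
  also have "hderiv a b s (\<lambda>t. \<Sum>k<N. c k * Y k i t) t = (\<Sum>k<N. hderiv a b s (\<lambda>t. c k * Y k i t) t)"
    by (rule hderiv_sum[of _ n]) (use assms C in auto)
  also have "\<dots> = (\<Sum>k<N. c k * hderiv a b s (Y k i) t)"
    by (intro sum.cong refl hderiv_cmult[of n]) (use assms C in auto)
  finally show ?thesis .
qed

lemma solves_ode_shift_comb:
  assumes y: "y \<in> Cvec a b n m" and Y: "\<And>k. k < N \<Longrightarrow> Y k \<in> Cvec a b n m" and r: "r \<le> n"
    and "solves_ode a b r m A f y" and "\<And>k. k < N \<Longrightarrow> solves_ode a b r m A (\<lambda>i t. 0) (Y k)"
  shows "solves_ode a b r m A f (shift_comb N y c Y)"
proof -
  have "K \<le> N \<Longrightarrow> solves_ode a b r m A f (shift_comb K y c Y)" for K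
  proof (induction K)
    case 0
    then show ?case using assms by (simp add: shift_comb_def[abs_def])
  next
    case (Suc K)
    have 1: "shift_comb K y c Y \<in> Cvec a b n m" using y Y Suc.prems by (intro shift_comb_Cvec) auto
    have 2: "solves_ode a b r m A (\<lambda>i t. c K * 0) (\<lambda>i t. c K * Y K i t)"
      using Suc.prems assms by (intro solves_ode_cmult[of _ n]) auto
    have 3: "(\<lambda>i t. c K * Y K i t) \<in> Cvec a b n m" using Y Suc.prems by (intro Cvec_cmult) auto
    show ?case
      using solves_ode_add[OF 1 3 r _ 2, of f] Suc by (simp add: shift_comb_def[abs_def] algebra_simps)
  qed
  then show ?thesis by blast
qed

lemma bop_shift_comb:
  assumes B: "cont_linear_bop a b n m N' B" and y: "y \<in> Cvec a b n m"
    and Y: "\<And>k. k < N \<Longrightarrow> Y k \<in> Cvec a b n m" and i: "i < N'"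
  shows "B (shift_comb N y c Y) i = B y i + (\<Sum>k<N. c k * B (Y k) i)"
proof -
  have "(\<lambda>i t. \<Sum>k<N. c k * Y k i t) \<in> Cvec a b n m" by (intro Cvec_sum Cvec_cmult Y) auto
  then show ?thesis
    using bop_add[OF B y _ i] bop_lincomb[OF B _ i, of "{..<N}" Y c] Y
    by (simp add: shift_comb_def[abs_def])
qed

lemma vinterp_shift_comb:
  assumes "y \<in> Cvec a b n m" and "\<And>k. k < N \<Longrightarrow> Y k \<in> Cvec a b n m"
  shows "vinterp n m k (shift_comb N y c Y) = shift_comb N (vinterp n m k y) c (\<lambda>i. vinterp n m k (Y i))"
proof (intro ext)
  fix i t
  show "vinterp n m k (shift_comb N y c Y) i t = shift_comb N (vinterp n m k y) c (\<lambda>i. vinterp n m k (Y i)) i t"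
  proof (cases "i < m")
    case True
    have h: "hderiv a b l (shift_comb N y c Y i) (node k (j - 1)) = hderiv a b l (y i) (node k (j - 1)) +
        (\<Sum>p<N. c p * hderiv a b l (Y p i) (node k (j - 1)))" if "j \<in> {1..Suc k}" "l \<le> n" for j l
      by (rule hderiv_shift_comb) (use assms that True node_in[of "j - 1" k] in auto)
    have "interp n k (shift_comb N y c Y i) t = (\<Sum>j=1..Suc k. \<Sum>l\<le>n.
        hderiv a b l (y i) (node k (j - 1)) * interp_basis n k j l t +
        (\<Sum>p<N. c p * (hderiv a b l (Y p i) (node k (j - 1)) * interp_basis n k j l t)))"
      unfolding interp_def
      by (intro sum.cong refl) (simp only: h atMost_iff distrib_right sum_distrib_right mult.assoc)
    also have "\<dots> = interp n k (y i) t + (\<Sum>j=1..Suc k. \<Sum>l\<le>n. \<Sum>p<N.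
        c p * (hderiv a b l (Y p i) (node k (j - 1)) * interp_basis n k j l t))"
      unfolding interp_def by (simp only: sum.distrib)
    also have "(\<Sum>j=1..Suc k. \<Sum>l\<le>n. \<Sum>p<N. c p * (hderiv a b l (Y p i) (node k (j - 1)) * interp_basis n k j l t)) =
        (\<Sum>j=1..Suc k. \<Sum>p<N. \<Sum>l\<le>n. c p * (hderiv a b l (Y p i) (node k (j - 1)) * interp_basis n k j l t))"
      by (intro sum.cong refl sum.swap)
    also have "\<dots> = (\<Sum>p<N. \<Sum>j=1..Suc k. \<Sum>l\<le>n. c p * (hderiv a b l (Y p i) (node k (j - 1)) * interp_basis n k j l t))"
      by (rule sum.swap)
    also have "\<dots> = (\<Sum>p<N. c p * interp n k (Y p i) t)"
      unfolding interp_def by (simp only: sum_distrib_left)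
    finally have "interp n k (shift_comb N y c Y i) t = interp n k (y i) t + (\<Sum>p<N. c p * interp n k (Y p i) t)" .
    moreover have "shift_comb N (vinterp n m k y) c (\<lambda>i. vinterp n m k (Y i)) i t =
        interp n k (y i) t + (\<Sum>p<N. c p * interp n k (Y p i) t)"
      using True by (simp add: vinterp_def shift_comb_def)
    ultimately show ?thesis using True by (simp add: vinterp_def)
  qed (simp add: vinterp_def shift_comb_def)
qed

lemma cvnorm_shift_comb_minus_le:
  assumes "y \<in> Cvec a b n m" and "\<And>k. k < N \<Longrightarrow> Y k \<in> Cvec a b n m" and "z \<in> Cvec a b n m"
  shows "cvnorm a b n m (\<lambda>i t. shift_comb N y c Y i t - z i t) \<le>
    cvnorm a b n m (\<lambda>i t. y i t - z i t) + (\<Sum>k<N. norm (c k) * cvnorm a b n m (Y k))"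
proof -
  have "(\<lambda>i t. shift_comb N y c Y i t - z i t) = (\<lambda>i t. (y i t - z i t) + (\<Sum>k<N. c k * Y k i t))"
    by (simp add: shift_comb_def fun_eq_iff)
  then have "cvnorm a b n m (\<lambda>i t. shift_comb N y c Y i t - z i t) \<le>
      cvnorm a b n m (\<lambda>i t. y i t - z i t) + cvnorm a b n m (\<lambda>i t. \<Sum>k<N. c k * Y k i t)"
    using assms by (auto intro!: cvnorm_add_le Cvec_diff Cvec_sum Cvec_cmult)
  also have "cvnorm a b n m (\<lambda>i t. \<Sum>k<N. c k * Y k i t) \<le> (\<Sum>k<N. cvnorm a b n m (\<lambda>i t. c k * Y k i t))"
    using assms by (intro cvnorm_sum_le Cvec_cmult) auto
  also have "\<dots> \<le> (\<Sum>k<N. norm (c k) * cvnorm a b n m (Y k))"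
    using assms by (intro sum_mono cvnorm_cmult_le) auto
  finally show ?thesis by simp
qed

end

subsection \<open>The approximation theorem\<close>

text \<open>For \<open>k \<ge> k0\<close> the solutions are unique, so quantifying over every
  sequence \<open>ys\<close> of solutions amounts to naming the solutions themselves.\<close>

theorem theorem1:
  fixes a b :: real and n r m :: nat
    and A :: "nat \<Rightarrow> nat \<Rightarrow> nat \<Rightarrow> real \<Rightarrow> complex"
    and B :: "(nat \<Rightarrow> real \<Rightarrow> complex) \<Rightarrow> nat \<Rightarrow> complex"
    and X :: "(nat \<Rightarrow> nat \<Rightarrow> real \<Rightarrow> complex) set"
  assumes "a < b" and "1 \<le> r" and "r \<le> n" and "1 \<le> m"
    and A_reg: "\<forall>s<r. A s \<in> Cmat a b (n - r) m"
    and B_cl: "cont_linear_bop a b n m (r * m) B"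
    and uniq: "\<forall>f\<in>Cvec a b (n - r) m. \<forall>q :: nat \<Rightarrow> complex.
                 \<exists>!y. y \<in> Cvec a b n m \<and> solves_ode a b r m A f y \<and> (\<forall>i<r*m. B y i = q i)"
    and X_sub: "X \<subseteq> Cmat a b (n - r) m"
    and X_dense: "\<forall>M\<in>Cmat a b (n - r) m. \<forall>e>0. \<exists>Y\<in>X. cmnorm a b (n - r) m (\<lambda>i j t. M i j t - Y i j t) < e"
  shows "\<exists>(Ak :: nat \<Rightarrow> nat \<Rightarrow> nat \<Rightarrow> nat \<Rightarrow> real \<Rightarrow> complex) (p :: nat \<Rightarrow> nat)
           (tp :: nat \<Rightarrow> nat \<Rightarrow> real) (\<beta> :: nat \<Rightarrow> nat \<Rightarrow> nat \<Rightarrow> nat \<Rightarrow> nat \<Rightarrow> complex).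
           (\<forall>k\<ge>1. (\<forall>s<r. Ak k s \<in> X) \<and> (\<forall>j\<in>{1..p k}. tp k j \<in> {a..b}))
         \<and> (\<exists>k0\<ge>1.
              (\<forall>k\<ge>k0. \<forall>f\<in>Cvec a b (n - r) m. \<forall>q :: nat \<Rightarrow> complex.
                 \<exists>!y. y \<in> Cvec a b n m \<and> solves_ode a b r m (Ak k) f y
                      \<and> multipoint_bc a b n r m (p k) (tp k) (\<beta> k) q y)
            \<and> (\<forall>f\<in>Cvec a b (n - r) m. \<forall>q :: nat \<Rightarrow> complex.
                 \<forall>ys y. (\<forall>k\<ge>k0. ys k \<in> Cvec a b n m \<and> solves_ode a b r m (Ak k) f (ys k)
                                 \<and> multipoint_bc a b n r m (p k) (tp k) (\<beta> k) q (ys k))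
                      \<longrightarrow> y \<in> Cvec a b n m \<longrightarrow> solves_ode a b r m A f y
                      \<longrightarrow> (\<forall>i<r*m. B y i = q i)
                      \<longrightarrow> ((\<lambda>k. cvnorm a b n m (\<lambda>i t. ys k i t - y i t)) \<longlonglongrightarrow> 0)))"
proof -
  interpret compact_interval a b by unfold_locales fact
  let ?l = "n - r" and ?N = "r * m"
  \<comment> \<open>The 1 leaves room for the approximating coefficients, so that one bound covers
    \<open>A\<close> and all \<open>Ak k\<close>.\<close>
  define M where "M = (\<Sum>s<r. cmnorm a b ?l m (A s)) + 1"
  have A: "A s \<in> Cmat a b ?l m" if "s < r" for s using A_reg that by blast
  have AM: "cmnorm a b ?l m (A s) + 1 \<le> M" if "s < r" for s
    unfolding M_def using that
    by (intro add_right_mono member_le_sum) (auto intro: A cmnorm_nonneg)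
  have M: "0 \<le> M" unfolding M_def by (intro add_nonneg_nonneg sum_nonneg) (auto intro: A cmnorm_nonneg)

  have "\<exists>Y. Y \<in> X \<and> cmnorm a b ?l m (\<lambda>i j t. A s i j t - Y i j t) < 1 / real (Suc k)"
    if "s < r" for k s
  proof -
    have "0 < 1 / real (Suc k)" by simp
    from X_dense[rule_format, OF A[OF that] this] show ?thesis by blast
  qed
  then have "\<forall>k s. \<exists>Y. s < r \<longrightarrow> Y \<in> X \<and> cmnorm a b ?l m (\<lambda>i j t. A s i j t - Y i j t) < 1 / real (Suc k)"
    by blast
  from this[unfolded choice_iff] obtain Ak where AkX: "\<And>k s. s < r \<Longrightarrow> Ak k s \<in> X"
    and Ak_close: "\<And>k s. s < r \<Longrightarrow> cmnorm a b ?l m (\<lambda>i j t. A s i j t - Ak k s i j t) < 1 / real (Suc k)"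
    by blast
  have AkC: "Ak k s \<in> Cmat a b ?l m" if "s < r" for k s using AkX X_sub that by blast
  have AkM: "cmnorm a b ?l m (Ak k s) \<le> M" if "s < r" for k s
  proof -
    have "1 / real (Suc k) \<le> 1" by simp
    then show ?thesis
      using cmnorm_le_diff[OF A AkC, OF that that, of k] Ak_close[OF that, of k] AM[OF that] by linarith
  qed
  define \<delta> where "\<delta> k = (\<Sum>s<r. cmnorm a b ?l m (\<lambda>i j t. A s i j t - Ak k s i j t))" for k
  have \<delta>: "\<delta> \<longlonglongrightarrow> 0"
  proof (rule tendsto_sandwich[where f = "\<lambda>_. 0"])
    show "\<forall>\<^sub>F k in sequentially. 0 \<le> \<delta> k"
      unfolding \<delta>_def by (intro always_eventually allI sum_nonneg cmnorm_nonneg Cmat_diff A AkC) auto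
    have "\<delta> k \<le> (\<Sum>s<r. 1 / real (Suc k))" for k
      unfolding \<delta>_def by (intro sum_mono less_imp_le Ak_close) auto
    then show "\<forall>\<^sub>F k in sequentially. \<delta> k \<le> (\<Sum>s<r. 1 / real (Suc k))" by simp
    show "(\<lambda>k. \<Sum>s<r. 1 / real (Suc k)) \<longlonglongrightarrow> 0"
      by (intro tendsto_null_sum LIMSEQ_Suc[OF lim_1_over_n])
  qed simp

  \<comment> \<open>\<open>C\<close> depends on the coefficients only through \<open>M\<close>,
    hence not on \<open>k\<close>.\<close>
  obtain C where transfer: "\<And>A A' z. (\<forall>s<r. A s \<in> Cmat a b ?l m) \<Longrightarrow>
      (\<forall>s<r. A' s \<in> Cmat a b ?l m \<and> cmnorm a b ?l m (A' s) \<le> M) \<Longrightarrow> z \<in> Cvec a b n m \<Longrightarrow>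
      \<exists>v\<in>Cvec a b n m. (\<forall>f. solves_ode a b r m A f z \<longrightarrow> solves_ode a b r m A' f v) \<and>
        (\<forall>s<r. \<forall>i<m. hderiv a b s (v i) a = hderiv a b s (z i) a) \<and>
        cvnorm a b n m (\<lambda>i t. v i t - z i t) \<le>
          C * (\<Sum>s<r. cmnorm a b ?l m (\<lambda>i j t. A s i j t - A' s i j t)) * cvnorm a b n m z"
    using ivp_transfer[OF \<open>1 \<le> r\<close> \<open>r \<le> n\<close> M, of m] by blast
  have "\<exists>v. v \<in> Cvec a b n m \<and> (\<forall>f. solves_ode a b r m A f z \<longrightarrow> solves_ode a b r m (Ak k) f v) \<and>
      (\<forall>s<r. \<forall>i<m. hderiv a b s (v i) a = hderiv a b s (z i) a) \<and>
      cvnorm a b n m (\<lambda>i t. v i t - z i t) \<le> C * \<delta> k * cvnorm a b n m z"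
    if "z \<in> Cvec a b n m" for k z
    using transfer[of A "Ak k" z] A AkC AkM that unfolding \<delta>_def by blast
  then have "\<forall>k z. \<exists>v. z \<in> Cvec a b n m \<longrightarrow> v \<in> Cvec a b n m \<and>
      (\<forall>f. solves_ode a b r m A f z \<longrightarrow> solves_ode a b r m (Ak k) f v) \<and>
      (\<forall>s<r. \<forall>i<m. hderiv a b s (v i) a = hderiv a b s (z i) a) \<and>
      cvnorm a b n m (\<lambda>i t. v i t - z i t) \<le> C * \<delta> k * cvnorm a b n m z"
    by blast
  from this[unfolded choice_iff] obtain V where V: "\<And>k z. z \<in> Cvec a b n m \<Longrightarrow> V k z \<in> Cvec a b n m"
    and V_sol: "\<And>k z f. z \<in> Cvec a b n m \<Longrightarrow> solves_ode a b r m A f z \<Longrightarrow> solves_ode a b r m (Ak k) f (V k z)"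
    and V_init: "\<And>k z s i. z \<in> Cvec a b n m \<Longrightarrow> s < r \<Longrightarrow> i < m \<Longrightarrow> hderiv a b s (V k z i) a = hderiv a b s (z i) a"
    and V_close: "\<And>k z. z \<in> Cvec a b n m \<Longrightarrow>
      cvnorm a b n m (\<lambda>i t. V k z i t - z i t) \<le> C * \<delta> k * cvnorm a b n m z"
    by blast
  have V_lim: "(\<lambda>k. cvnorm a b n m (\<lambda>i t. V k z i t - z i t)) \<longlonglongrightarrow> 0" if z: "z \<in> Cvec a b n m" for z
  proof (rule tendsto_sandwich[where f = "\<lambda>_. 0"])
    show "\<forall>\<^sub>F k in sequentially. 0 \<le> cvnorm a b n m (\<lambda>i t. V k z i t - z i t)"
      by (intro always_eventually allI cvnorm_nonneg Cvec_diff V z)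
    show "\<forall>\<^sub>F k in sequentially. cvnorm a b n m (\<lambda>i t. V k z i t - z i t) \<le> C * \<delta> k * cvnorm a b n m z"
      by (intro always_eventually allI V_close z)
    show "(\<lambda>k. C * \<delta> k * cvnorm a b n m z) \<longlonglongrightarrow> 0"
      by (intro tendsto_mult_left_zero tendsto_mult_right_zero \<delta>)
  qed simp

  \<comment> \<open>Well-posedness of the original problem supplies homogeneous solutions dual to
    the components of \<open>B\<close>.\<close>
  have "\<exists>y. y \<in> Cvec a b n m \<and> solves_ode a b r m A (\<lambda>i t. 0) y \<and> (\<forall>j<?N. B y j = (if i = j then 1 else 0))" for i
    using uniq[rule_format, OF Cvec_zero, of "\<lambda>j. if i = j then 1 else 0"] by blast
  then have "\<forall>i. \<exists>y. y \<in> Cvec a b n m \<and> solves_ode a b r m A (\<lambda>i t. 0) y \<and>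
      (\<forall>j<?N. B y j = (if i = j then 1 else 0))" by blast
  from this[unfolded choice_iff] obtain Y where Y: "\<And>i. Y i \<in> Cvec a b n m" and Y_sol: "\<And>i. solves_ode a b r m A (\<lambda>i t. 0) (Y i)"
    and BY: "\<And>i j. j < ?N \<Longrightarrow> B (Y i) j = (if i = j then 1 else 0)"
    by blast

  have B_lim: "(\<lambda>k. B (vinterp n m k (V k z)) j) \<longlonglongrightarrow> B z j" if "z \<in> Cvec a b n m" "j < ?N" for z j
    by (rule bop_tendsto[OF B_cl vinterp_Cvec that(1) vinterp_tendsto_along that(2)]) (use that V V_lim in auto)
  \<comment> \<open>Row \<open>j\<close> is a component of the approximate boundary operator, column
    \<open>i\<close> a transferred homogeneous solution. The matrix tends to the identity by
    \<open>B_lim\<close> and \<open>BY\<close>.\<close>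
  define E where "E k j i = B (vinterp n m k (V k (Y i))) j" for k j i
  have "\<forall>\<^sub>F k in sequentially. \<forall>j\<in>{..<?N}. (\<Sum>i<?N. norm (E k j i - (if i = j then 1 else 0))) < 1/2"
  proof (intro eventually_ball_finite ballI)
    fix j assume "j \<in> {..<?N}"
    then have "(\<lambda>k. E k j i - (if i = j then 1 else 0)) \<longlonglongrightarrow> 0" for i
      using B_lim[OF Y, of j i] BY[of j i] unfolding E_def by (intro LIM_zero) simp
    then have "(\<lambda>k. \<Sum>i<?N. norm (E k j i - (if i = j then 1 else 0))) \<longlonglongrightarrow> 0"
      by (intro tendsto_null_sum tendsto_norm_zero)
    then show "\<forall>\<^sub>F k in sequentially. (\<Sum>i<?N. norm (E k j i - (if i = j then 1 else 0))) < 1/2"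
      by (rule order_tendstoD(2)) simp
  qed simp
  then obtain k1 where k1: "\<And>k j. k1 \<le> k \<Longrightarrow> j < ?N \<Longrightarrow> (\<Sum>i<?N. norm (E k j i - (if i = j then 1 else 0))) \<le> 1/2"
    unfolding eventually_sequentially by (metis lessThan_iff less_imp_le)
  define k0 where "k0 = max 1 k1"

  let ?comb = "\<lambda>k y c. shift_comb ?N (V k y) c (\<lambda>i. V k (Y i))"
  let ?mp = "\<lambda>k q y. multipoint_bc a b n r m (Suc k) (\<lambda>j. node k (j - 1)) (\<lambda>j l i c. B (unit_basis n m k j l c) i) q y"
  have comb: "?comb k y c \<in> Cvec a b n m" if "y \<in> Cvec a b n m" for k y c
    using that V Y by (intro shift_comb_Cvec) auto
  have comb_sol: "solves_ode a b r m (Ak k) f (?comb k y c)"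
    if "y \<in> Cvec a b n m" "solves_ode a b r m A f y" for k y c f
    by (rule solves_ode_shift_comb[of _ n]) (use that V Y V_sol Y_sol \<open>r \<le> n\<close> in auto)
  have comb_mp: "?mp k q (?comb k y c) \<longleftrightarrow>
      (\<forall>j<?N. (\<Sum>i<?N. c i * E k j i) = q j - B (vinterp n m k (V k y)) j)"
    if "y \<in> Cvec a b n m" for k q y c
  proof -
    have "B (vinterp n m k (?comb k y c)) j = B (vinterp n m k (V k y)) j + (\<Sum>i<?N. c i * E k j i)" if "j < ?N" for j
      using bop_shift_comb[OF B_cl vinterp_Cvec vinterp_Cvec that] vinterp_shift_comb[OF V[OF \<open>y \<in> _\<close>] V[OF Y]]
      by (simp add: E_def)
    then show ?thesis unfolding multipoint_bc_iff[OF B_cl] by (auto simp: eq_diff_eq add.commute)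
  qed
  \<comment> \<open>The solution \<open>x\<close> is carried back to a solution \<open>z\<close> of
    the original equation with the same initial data. Well-posedness writes \<open>z\<close> as
    \<open>y\<close> plus a combination of the \<open>Y i\<close>. The same combination of
    transferred functions has the initial data of \<open>x\<close>, hence equals
    \<open>x\<close>.\<close>
  have rep: "\<exists>c. x = ?comb k y c"
    if x: "x \<in> Cvec a b n m" "solves_ode a b r m (Ak k) f x" and y: "y \<in> Cvec a b n m" "solves_ode a b r m A f y"
      and f: "f \<in> Cvec a b ?l m" for k x y f
  proof -
    have "\<forall>s<r. A s \<in> Cmat a b ?l m \<and> cmnorm a b ?l m (A s) \<le> M" using A AM by fastforce
    then obtain z where z: "z \<in> Cvec a b n m" "solves_ode a b r m A f z"
      and z_init: "\<And>s i. s < r \<Longrightarrow> i < m \<Longrightarrow> hderiv a b s (z i) a = hderiv a b s (x i) a"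
      using transfer[of "Ak k" A x] AkC x by blast
    \<comment> \<open>Duality of the \<open>Y i\<close> to \<open>B\<close> makes these the
      coefficients for which both functions have the same boundary values.\<close>
    define c where "c j = B z j - B y j" for j
    let ?w = "shift_comb ?N y c Y"
    have w: "?w \<in> Cvec a b n m" using y Y by (intro shift_comb_Cvec) auto
    have "solves_ode a b r m A f ?w"
      by (rule solves_ode_shift_comb[of _ n]) (use y Y Y_sol \<open>r \<le> n\<close> in auto)
    moreover have "B ?w j = B z j" if "j < ?N" for j
    proof -
      have "(\<Sum>i<?N. c i * B (Y i) j) = (\<Sum>i<?N. if i = j then c i else 0)"
        using that by (intro sum.cong) (auto simp: BY)
      then show ?thesis
        using bop_shift_comb[OF B_cl y(1) Y that, of ?N c] that by (simp add: sum.delta c_def)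
    qed
    ultimately have "z = ?w"
      using uniq[rule_format, OF f, of "B z"] z w by blast
    then have "hderiv a b s (x i) a = hderiv a b s (?comb k y c i) a" if "s < r" "i < m" for s i
      using hderiv_shift_comb[of y n m ?N Y s i a c] hderiv_shift_comb[of "V k y" n m ?N "\<lambda>i. V k (Y i)" s i a c]
        z_init[OF that] V_init that y Y V \<open>r \<le> n\<close> \<open>a < b\<close> by simp
    then have "x = ?comb k y c"
      using ivp_unique[OF AkC \<open>r \<le> n\<close> x(1) comb[OF y(1)] x(2) comb_sol[OF y]] by blast
    then show ?thesis by blast
  qed

  have unique: "\<exists>!x. x \<in> Cvec a b n m \<and> solves_ode a b r m (Ak k) f x \<and> ?mp k q x"
    if k: "k0 \<le> k" and f: "f \<in> Cvec a b ?l m" for k f q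
  proof -
    \<comment> \<open>Any particular solution of the original equation will do here; its boundary
      values are arbitrary.\<close>
    obtain y where y: "y \<in> Cvec a b n m" "solves_ode a b r m A f y" using uniq f by blast
    have kE: "(\<Sum>i<?N. norm (E k j i - (if i = j then 1 else 0))) \<le> 1/2" if "j < ?N" for j
      using k1 k that by (simp add: k0_def)
    obtain c where c: "\<forall>j<?N. (\<Sum>i<?N. c i * E k j i) = q j - B (vinterp n m k (V k y)) j"
      using near_identity_solvable[of ?N "E k" "\<lambda>j. q j - B (vinterp n m k (V k y)) j", OF kE] by blast
    have "x = ?comb k y c" if x: "x \<in> Cvec a b n m" "solves_ode a b r m (Ak k) f x" "?mp k q x" for x
    proof -
      obtain c' where c': "x = ?comb k y c'" using rep[OF x(1,2) y f] by blast
      then have "\<forall>j<?N. (\<Sum>i<?N. c' i * E k j i) = q j - B (vinterp n m k (V k y)) j"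
        using comb_mp[OF y(1)] x(3) by blast
      then have "(\<Sum>i<?N. (c' i - c i) * E k j i) = 0" if "j < ?N" for j
        using c that by (simp add: left_diff_distrib sum_subtractf)
      \<comment> \<open>The difference of the coefficients solves the homogeneous system, so the
        bound with \<open>Q = 0\<close> applies.\<close>
      then have "c' i = c i" if "i < ?N" for i
        using near_identity_bound[of ?N "E k" "\<lambda>i. c' i - c i" "\<lambda>_. 0" 0 i, OF kE] that by simp
      then show ?thesis unfolding c' by (simp add: shift_comb_def[abs_def])
    qed
    then show ?thesis using comb[OF y(1)] comb_sol[OF y] comb_mp[OF y(1)] c by (intro ex1I[of _ "?comb k y c"]) auto
  qed

  have converges: "(\<lambda>k. cvnorm a b n m (\<lambda>i t. ys k i t - y i t)) \<longlonglongrightarrow> 0"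
    if f: "f \<in> Cvec a b ?l m"
      and ys: "\<forall>k\<ge>k0. ys k \<in> Cvec a b n m \<and> solves_ode a b r m (Ak k) f (ys k) \<and> ?mp k q (ys k)"
      and y: "y \<in> Cvec a b n m" "solves_ode a b r m A f y" "\<forall>i<?N. B y i = q i" for f q ys y
  proof (rule tendsto_sandwich[where f = "\<lambda>_. 0"])
    \<comment> \<open>A bound for the right-hand side of the linear system relative to
      \<open>V k y\<close>. Now \<open>B y = q\<close> holds, so it tends to 0 and the coefficients
      follow.\<close>
    define Q where "Q k = (\<Sum>j<?N. norm (q j - B (vinterp n m k (V k y)) j))" for k
    \<comment> \<open>The norm of \<open>V k (Y i)\<close> is replaced by the norm of
      \<open>Y i\<close> plus a deviation tending to 0, so the factor beside \<open>Q k\<close>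
      stays bounded.\<close>
    define R where "R k = cvnorm a b n m (\<lambda>i t. V k y i t - y i t) +
      (\<Sum>i<?N. 2 * Q k * (cvnorm a b n m (Y i) + cvnorm a b n m (\<lambda>j t. V k (Y i) j t - Y i j t)))" for k
    have "(\<lambda>k. q j - B (vinterp n m k (V k y)) j) \<longlonglongrightarrow> q j - B y j" if "j < ?N" for j
      using B_lim[OF y(1) that] by (intro tendsto_intros)
    then have "Q \<longlonglongrightarrow> 0"
      unfolding Q_def using y(3) by (intro tendsto_null_sum tendsto_norm_zero) simp
    then have "(\<lambda>k. 2 * Q k * (cvnorm a b n m (Y i) + cvnorm a b n m (\<lambda>j t. V k (Y i) j t - Y i j t)))
        \<longlonglongrightarrow> 2 * 0 * (cvnorm a b n m (Y i) + 0)" for i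
      by (intro tendsto_intros V_lim Y)
    then show "R \<longlonglongrightarrow> 0"
      unfolding R_def by (intro tendsto_add_zero tendsto_null_sum V_lim y) simp
    show "\<forall>\<^sub>F k in sequentially. 0 \<le> cvnorm a b n m (\<lambda>i t. ys k i t - y i t)"
      using ys y by (auto simp: eventually_sequentially intro!: exI[of _ k0] cvnorm_nonneg Cvec_diff)
    have "cvnorm a b n m (\<lambda>i t. ys k i t - y i t) \<le> R k" if k: "k0 \<le> k" for k
    proof -
      obtain c where c: "ys k = ?comb k y c" using rep[of "ys k" k f y] ys y f k by blast
      then have "\<forall>j<?N. (\<Sum>i<?N. c i * E k j i) = q j - B (vinterp n m k (V k y)) j"
        using comb_mp[OF y(1), of k q c] ys k by auto
      moreover have "norm (q j - B (vinterp n m k (V k y)) j) \<le> Q k" if "j < ?N" for j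
        unfolding Q_def by (rule member_le_sum) (use that in auto)
      ultimately have cb: "norm (c i) \<le> 2 * Q k" if "i < ?N" for i
        using near_identity_bound[of ?N "E k" c "\<lambda>j. q j - B (vinterp n m k (V k y)) j" "Q k" i] k1 k that
        by (simp add: k0_def)
      have "0 \<le> Q k" unfolding Q_def by (intro sum_nonneg) simp
      have "cvnorm a b n m (\<lambda>i t. ys k i t - y i t) \<le> cvnorm a b n m (\<lambda>i t. V k y i t - y i t) +
          (\<Sum>i<?N. norm (c i) * cvnorm a b n m (V k (Y i)))"
        unfolding c using y V Y by (intro cvnorm_shift_comb_minus_le) auto
      also have "\<dots> \<le> R k"
        unfolding R_def
        by (intro add_left_mono sum_mono mult_mono cb cvnorm_le_diff cvnorm_nonneg V Y) (use \<open>0 \<le> Q k\<close> in auto)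
      finally show ?thesis .
    qed
    then show "\<forall>\<^sub>F k in sequentially. cvnorm a b n m (\<lambda>i t. ys k i t - y i t) \<le> R k"
      unfolding eventually_sequentially by blast
  qed simp

  show ?thesis
  \<comment> \<open>There are \<open>k + 1\<close> points because a Bernstein polynomial of degree
    \<open>k\<close> has nodes \<open>0\<close> to \<open>k\<close>; points are counted from 1,
    whence the shift \<open>j - 1\<close>.\<close>
  proof (rule exI[of _ Ak], rule exI[of _ Suc], rule exI[of _ "\<lambda>k j. node k (j - 1)"],
      rule exI[of _ "\<lambda>k j l i c. B (unit_basis n m k j l c) i"], intro conjI exI[of _ k0] allI impI ballI)
    show "Ak k s \<in> X" if "s < r" for k s using AkX that .
    show "node k (j - 1) \<in> {a..b}" if "j \<in> {1..Suc k}" for k j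
      using that by (intro node_in) auto
    show "1 \<le> k0" by (simp add: k0_def)
  qed (use unique converges in blast)+
qed

end
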